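(* Let $d\ge2$, let $a_1,\dots,a_d>0$, $a=\sum_{i=1}^d a_i$, and let $\rho\ge1$ be an integer. Let $K_v$ be the Schur clique of $(a_1,\dots,a_d)$ and $\widehat K_v$ the random CAST-$\rho$ update. Let $Y_v=K_v^{+/2}(\widehat K_v-K_v)K_v^{+/2}$ be the normalized local Schur error. Then $$\mathbb E[Y_v]=0,\qquad \mathbb E[Y_v^2]\preceq\frac1\rho\,\Pi_{K_v}.$$
   Context: $\mathbf e_1,\dots,\mathbf e_d$ is the standard basis of $\mathbb R^d$. The Schur clique is the $d\times d$ Laplacian $$K_v=\sum_{1\le i<j\le d}\frac{a_ia_j}{a}(\mathbf e_i-\mathbf e_j)(\mathbf e_i-\mathbf e_j)^\top .$$ (It arises from eliminating a pivot vertex $v$ with neighbors $u_1,\dots,u_d$, identified with $[d]$, and incident edge weights $a_i$.) CAST-$\rho$ update. For each $i\in[d]$ let $P_i=\{(i,1),\dots,(i,\rho)\}$ be a block of $\rho$ auxiliary copies, each $p\in P_i$ having conductance $c_p=a_i/\rho$ and label $\phi(p)=i$. Let $P=\bigcup_i P_i$. The expanded Schur clique is the complete graph on $P$ with edge weights $w^{\mathrm{exp}}_{pq}=c_pc_q/a$ for $p\ne q$. Let $T$ be a random spanning tree of it with $\mathbb P(T)\propto\prod_{(p,q)\in T}w^{\mathrm{exp}}_{pq}$. Then $$\widehat K_v=\sum_{(p,q)\in T,\ \phi(p)\ne\phi(q)}\frac{c_pc_q}{c_p+c_q}\,(\mathbf e_{\phi(p)}-\mathbf e_{\phi(q)})(\mathbf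 e_{\phi(p)}-\mathbf e_{\phi(q)})^\top .$$ $K_v^+$ is the Moore--Penrose pseudoinverse, $K_v^{+/2}=(K_v^+)^{1/2}$, and $\Pi_{K_v}=K_v^{+/2}K_vK_v^{+/2}$ is the orthogonal projection onto $\operatorname{range}(K_v)=\mathbf 1_d^\perp$. $\preceq$ is the Loewner order on symmetric matrices. *)

theory Defs
  imports "HOL-Analysis.Analysis" "HOL-Probability.Probability_Mass_Function"
begin

section \<open>Matrices\<close>

definition outer_product :: "real ^ 'n \<Rightarrow> real ^ 'm \<Rightarrow> real ^ 'm ^ 'n" where
  "outer_product u v = (\<chi> i j. u $ i * v $ j)"

definition psd :: "real ^ 'n ^ 'n \<Rightarrow> bool" where
  "psd A \<longleftrightarrow> transpose A = A \<and> (\<forall>x. 0 \<le> x \<bullet> (A *v x))"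

definition loewner_le :: "real ^ 'n ^ 'n \<Rightarrow> real ^ 'n ^ 'n \<Rightarrow> bool"  (infix \<open>\<preceq>\<^sub>L\<close> 50) where
  "A \<preceq>\<^sub>L B \<longleftrightarrow> transpose A = A \<and> transpose B = B \<and> psd (B - A)"

text \<open>The four Penrose conditions.\<close>

definition is_pseudoinverse :: "real ^ 'n ^ 'm \<Rightarrow> real ^ 'm ^ 'n \<Rightarrow> bool" where
  "is_pseudoinverse A X \<longleftrightarrow>
     A ** X ** A = A \<and> X ** A ** X = X \<and>
     transpose (A ** X) = A ** X \<and> transpose (X ** A) = X ** A"

definition pseudoinverse :: "real ^ 'n ^ 'm \<Rightarrow> real ^ 'm ^ 'n" where
  "pseudoinverse A = (THE X. is_pseudoinverse A X)"

text \<open>Meaningful for positive semidefinite arguments only.\<close>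

definition psd_sqrt :: "real ^ 'n ^ 'n \<Rightarrow> real ^ 'n ^ 'n" where
  "psd_sqrt A = (THE S. psd S \<and> S ** S = A)"


section \<open>Random spanning trees of a weighted complete graph\<close>

text \<open>
  Undirected edges are two-element sets of vertices, and a spanning tree is identified with
  its edge set. The predicate \<open>spanning_tree\<close> of the AFP entry Graph-Theory is not suitable: it
  only excludes directed cycles.
\<close>

definition complete_edges :: "'v set \<Rightarrow> 'v set set" where
  "complete_edges V = {{p, q} | p q. p \<in> V \<and> q \<in> V \<and> p \<noteq> q}"

definition connected_edges :: "'v set \<Rightarrow> 'v set set \<Rightarrow> bool" where
  "connected_edges V E \<longleftrightarrow> (\<forall>p\<in>V. \<forall>q\<in>V. (p, q) \<in> {(x, y). {x, y} \<in> E}\<^sup>*)"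

definition is_cycle :: "'v set set \<Rightarrow> 'v list \<Rightarrow> bool" where
  "is_cycle E vs \<longleftrightarrow>
     3 \<le> length vs \<and> distinct vs \<and> successively (\<lambda>x y. {x, y} \<in> E) vs \<and> {last vs, hd vs} \<in> E"

definition spanning_trees :: "'v set \<Rightarrow> 'v set set set" where
  "spanning_trees V =
     {T. T \<subseteq> complete_edges V \<and> connected_edges V T \<and> (\<nexists>vs. is_cycle T vs)}"

definition tree_weight :: "('v set \<Rightarrow> real) \<Rightarrow> 'v set set \<Rightarrow> real" where
  "tree_weight w T = (\<Prod>e\<in>T. w e)"

definition random_spanning_tree :: "'v set \<Rightarrow> ('v set \<Rightarrow> real) \<Rightarrow> 'v set set pmf" where
  "random_spanning_tree V w = embed_pmf (\<lambda>T.
     if T \<in> spanning_trees V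
     then tree_weight w T / (\<Sum>T'\<in>spanning_trees V. tree_weight w T') else 0)"

lemma finite_complete_edges: "finite V \<Longrightarrow> finite (complete_edges V)"
  by (rule finite_subset[of _ "Pow V"]) (auto simp: complete_edges_def)

lemma finite_spanning_trees: "finite V \<Longrightarrow> finite (spanning_trees V)"
  by (rule finite_subset[of _ "Pow (complete_edges V)"])
     (auto simp: spanning_trees_def finite_complete_edges)

lemma star_in_spanning_trees:
  assumes "c \<in> V"
  shows "(\<lambda>x. {c, x}) ` (V - {c}) \<in> spanning_trees V"
proof -
  define S where "S = (\<lambda>x. {c, x}) ` (V - {c})"
  let ?R = "{(x, y). {x, y} \<in> S}"
  have to_c: "(x, c) \<in> ?R\<^sup>*" and from_c: "(c, x) \<in> ?R\<^sup>*" if "x \<in> V" for x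
  proof -
    have "x = c \<or> (x, c) \<in> ?R" "x = c \<or> (c, x) \<in> ?R"
      using that by (auto simp: S_def insert_commute)
    then show "(x, c) \<in> ?R\<^sup>*" "(c, x) \<in> ?R\<^sup>*" by auto
  qed
  have "connected_edges V S"
    unfolding connected_edges_def using to_c from_c by (meson rtrancl_trans)
  moreover have "S \<subseteq> complete_edges V"
    using assms by (auto simp: S_def complete_edges_def)
  moreover have "\<not> is_cycle S vs" for vs
  proof
    assume cyc: "is_cycle S vs"
    then obtain x y z ws where vs: "vs = x # y # z # ws"
      unfolding is_cycle_def numeral_3_eq_3 by (metis Suc_le_length_iff)
    have c: "c \<in> e" if "e \<in> S" for e using that by (auto simp: S_def)
    have "c \<in> {x, y}" "c \<in> {y, z}" "c \<in> {last vs, x}"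
      using cyc by (auto simp: is_cycle_def vs dest!: c)
    moreover have "distinct (x # y # z # ws)" using cyc vs by (simp add: is_cycle_def)
    moreover have "last vs \<in> set (z # ws)" by (simp add: vs)
    ultimately show False by auto
  qed
  ultimately show ?thesis by (auto simp: spanning_trees_def S_def)
qed

text \<open>The law is well defined, with probabilities proportional to the tree weights.\<close>

lemma
  assumes V: "finite V" "V \<noteq> {}" and w: "\<And>e. e \<in> complete_edges V \<Longrightarrow> 0 < w e"
  shows pmf_random_spanning_tree:
      "pmf (random_spanning_tree V w) T =
        (if T \<in> spanning_trees V
         then tree_weight w T / (\<Sum>T'\<in>spanning_trees V. tree_weight w T') else 0)"
    and set_pmf_random_spanning_tree:
      "set_pmf (random_spanning_tree V w) = spanning_trees V"
proof -
  let ?Z = "\<Sum>T'\<in>spanning_trees V. tree_weight w T'"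
  let ?f = "\<lambda>T. if T \<in> spanning_trees V then tree_weight w T / ?Z else 0"
  have fin: "finite (spanning_trees V)" using V by (simp add: finite_spanning_trees)
  have ne: "spanning_trees V \<noteq> {}" using V star_in_spanning_trees by fastforce
  have pos: "0 < tree_weight w T" if "T \<in> spanning_trees V" for T
    unfolding tree_weight_def using that w by (intro prod_pos) (auto simp: spanning_trees_def)
  have Z: "0 < ?Z" using fin ne pos by (intro sum_pos) auto
  have nonneg: "0 \<le> ?f T" for T using pos Z by (simp add: less_imp_le)
  have "(\<integral>\<^sup>+T. ennreal (?f T) \<partial>count_space UNIV) = (\<Sum>T\<in>spanning_trees V. ennreal (?f T))"
    by (rule nn_integral_count_space'[OF fin]) auto
  also have "\<dots> = ennreal (\<Sum>T\<in>spanning_trees V. ?f T)"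
    using nonneg by (intro sum_ennreal) blast
  also have "(\<Sum>T\<in>spanning_trees V. ?f T) = 1"
    using Z by (simp add: sum_divide_distrib[symmetric])
  finally have one: "(\<integral>\<^sup>+T. ennreal (?f T) \<partial>count_space UNIV) = 1" by simp
  show "pmf (random_spanning_tree V w) T = ?f T"
    unfolding random_spanning_tree_def by (rule pmf_embed_pmf[OF nonneg one])
  show "set_pmf (random_spanning_tree V w) = spanning_trees V"
    unfolding random_spanning_tree_def set_embed_pmf[OF nonneg one]
    using pos Z by (auto simp: less_imp_neq[THEN not_sym])
qed


section \<open>Schur clique and CAST update\<close>

text \<open>
  The neighbors are the elements of a finite linearly ordered type \<open>'n\<close>, which plays the role
  of \<open>[d]\<close> with \<open>d = CARD('n)\<close>.
\<close>

definition edge_laplacian :: "'n::finite \<Rightarrow> 'n \<Rightarrow> real ^ 'n ^ 'n" where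
  "edge_laplacian i j = outer_product (axis i 1 - axis j 1) (axis i 1 - axis j 1)"

definition schur_clique :: "('n::{finite,linorder} \<Rightarrow> real) \<Rightarrow> ((real, 'n) vec, 'n) vec" where
  "schur_clique a =
     (\<Sum>(i, j) \<in> {(i, j). i < j}. (a i * a j / (\<Sum>k\<in>UNIV. a k)) *\<^sub>R edge_laplacian i j)"

definition copies :: "nat \<Rightarrow> ('n \<times> nat) set" where
  "copies \<rho> = UNIV \<times> {1..\<rho>}"

abbreviation label :: "'n \<times> nat \<Rightarrow> 'n" where
  "label \<equiv> fst"

definition conductance :: "('n \<Rightarrow> real) \<Rightarrow> nat \<Rightarrow> 'n \<times> nat \<Rightarrow> real" where
  "conductance a \<rho> p = a (label p) / real \<rho>"

text \<open>For an edge \<open>e = {p, q}\<close> with \<open>p \<noteq> q\<close> the product below is \<open>c\<^sub>p c\<^sub>q\<close>.\<close>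

definition expanded_weight :: "('n::finite \<Rightarrow> real) \<Rightarrow> nat \<Rightarrow> ('n \<times> nat) set \<Rightarrow> real" where
  "expanded_weight a \<rho> e = (\<Prod>p\<in>e. conductance a \<rho> p) / (\<Sum>k\<in>UNIV. a k)"

definition cast_tree :: "('n::finite \<Rightarrow> real) \<Rightarrow> nat \<Rightarrow> ('n \<times> nat) set set pmf" where
  "cast_tree a \<rho> = random_spanning_tree (copies \<rho>) (expanded_weight a \<rho>)"

text \<open>
  Each tree edge whose endpoints have different labels is counted exactly once, oriented from
  the smaller label to the larger one; the summand is symmetric in the two endpoints.
\<close>

definition cast_update ::
    "('n::{finite,linorder} \<Rightarrow> real) \<Rightarrow> nat \<Rightarrow> ('n \<times> nat) set set \<Rightarrow> ((real, 'n) vec, 'n) vec" where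
  "cast_update a \<rho> T =
     (\<Sum>(p, q) \<in> {(p, q). {p, q} \<in> T \<and> label p < label q}.
        (conductance a \<rho> p * conductance a \<rho> q / (conductance a \<rho> p + conductance a \<rho> q))
          *\<^sub>R edge_laplacian (label p) (label q))"

definition pinv_sqrt :: "real ^ 'n ^ 'n \<Rightarrow> real ^ 'n ^ 'n" where
  "pinv_sqrt K = psd_sqrt (pseudoinverse K)"

definition range_projection :: "real ^ 'n ^ 'n \<Rightarrow> real ^ 'n ^ 'n" where
  "range_projection K = pinv_sqrt K ** K ** pinv_sqrt K"

definition schur_error ::
    "('n::{finite,linorder} \<Rightarrow> real) \<Rightarrow> nat \<Rightarrow> ('n \<times> nat) set set \<Rightarrow> ((real, 'n) vec, 'n) vec" where
  "schur_error a \<rho> T =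
     pinv_sqrt (schur_clique a) ** (cast_update a \<rho> T - schur_clique a)
       ** pinv_sqrt (schur_clique a)"

end

theory Submission
  imports Defs
begin

text \<open>
  The tree law has edge weights \<open>c\<^sub>p c\<^sub>q / a\<close>, and the weights of all trees containing a forest \<open>F\<close>
  sum to \<open>\<Prod>\<^sub>C c(C) / a\<close> over the components \<open>C\<close> of \<open>F\<close>, up to the weight of \<open>F\<close> itself: this follows
  by induction on the number of components, counting the pairs of a tree and one of its edges
  outside \<open>F\<close>. Hence \<open>p q\<close> is a tree edge with probability \<open>(c\<^sub>p + c\<^sub>q) / a\<close>, which makes the update
  unbiased; two disjoint edges are uncorrelated, and two edges \<open>e\<close>, \<open>f\<close> sharing the vertex \<open>p\<close> have
  covariance \<open>- w\<^sub>e w\<^sub>f / c\<^sub>p\<^sup>2\<close>.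

  For any vectors \<open>u\<^sub>e\<close> the second moment of \<open>\<Sum>\<^sub>e (1\<^sub>e - P\<^sub>e) u\<^sub>e\<close> is therefore \<open>\<Sum>\<^sub>e P\<^sub>e |u\<^sub>e|\<^sup>2\<close> minus a
  nonnegative quadratic form. With \<open>S = K\<^sup>+\<^sup>/\<^sup>2\<close> and \<open>u\<^sub>e = S X\<^sub>e S x\<close>, where \<open>X\<^sub>e\<close> is the rank-one
  contribution of the edge \<open>e\<close>, the identity \<open>b\<^sup>T K\<^sup>+ b = 1 / a\<^sub>i + 1 / a\<^sub>j\<close> for \<open>b = e\<^sub>i - e\<^sub>j\<close> gives
  \<open>S X\<^sub>e S\<close> the trace \<open>1 / \<rho>\<close>, so that \<open>|u\<^sub>e|\<^sup>2 = x\<^sup>T S X\<^sub>e S x / \<rho>\<close>, and \<open>\<Sum>\<^sub>e P\<^sub>e X\<^sub>e = K\<close>.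
\<close>

section \<open>Forests and their components\<close>

definition reachable :: "'v set set \<Rightarrow> ('v \<times> 'v) set" where
  "reachable E = {(x, y). {x, y} \<in> E}\<^sup>*"

text \<open>Acyclicity in the form that every edge is a bridge, which suits adding one edge at a
  time; \<open>forest_iff_no_cycle\<close> identifies it with the absence of cycles.\<close>

definition forest :: "'v set set \<Rightarrow> bool" where
  "forest E \<longleftrightarrow> (\<forall>x y. x \<noteq> y \<longrightarrow> {x, y} \<in> E \<longrightarrow> (x, y) \<notin> reachable (E - {{x, y}}))"

lemma equiv_reachable: "equiv UNIV (reachable E)"
proof (rule equivI)
  show "sym (reachable E)"
    unfolding reachable_def by (intro sym_rtrancl) (auto simp: sym_def insert_commute)
qed (auto simp: reachable_def refl_on_def trans_rtrancl)

lemma reachable_refl [simp]: "(x, x) \<in> reachable E"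
  by (simp add: reachable_def)

lemma reachable_sym: "(x, y) \<in> reachable E \<Longrightarrow> (y, x) \<in> reachable E"
  using equiv_reachable by (meson equivE symE)

lemma reachable_trans: "(x, y) \<in> reachable E \<Longrightarrow> (y, z) \<in> reachable E \<Longrightarrow> (x, z) \<in> reachable E"
  by (auto simp: reachable_def)

lemma reachable_edge: "{x, y} \<in> E \<Longrightarrow> (x, y) \<in> reachable E"
  by (auto simp: reachable_def)

lemma reachable_mono: "E \<subseteq> E' \<Longrightarrow> (x, y) \<in> reachable E \<Longrightarrow> (x, y) \<in> reachable E'"
  unfolding reachable_def by (rule subsetD[OF rtrancl_mono]) auto

text \<open>A walk can be shortened until it crosses the new edge at most once, so new connections
  arise only between the class of \<open>p\<close> and the class of \<open>q\<close>.\<close>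

lemma reachable_insert:
  "(x, y) \<in> reachable (insert {p, q} E) \<longleftrightarrow>
     (x, y) \<in> reachable E \<or> (x, p) \<in> reachable E \<and> (q, y) \<in> reachable E
       \<or> (x, q) \<in> reachable E \<and> (p, y) \<in> reachable E" (is "?L \<longleftrightarrow> ?R")
proof
  assume ?L
  then show ?R
    unfolding reachable_def[of "insert _ _"]
  proof (induction rule: rtrancl_induct)
    case base
    then show ?case by simp
  next
    case (step y z)
    from step(2) consider "{y, z} \<in> E" | "y = p" "z = q" | "y = q" "z = p"
      by (auto simp: doubleton_eq_iff)
    then show ?case
    proof cases
      case 1
      then show ?thesis using step(3) reachable_edge[OF 1] by (meson reachable_trans)
    next
      case 2
      then show ?thesis using step(3) by auto
    next
      case 3
      then show ?thesis using step(3) by auto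
    qed
  qed
next
  have "(u, v) \<in> reachable (insert {p, q} E)" if "(u, v) \<in> reachable E" for u v
    using that by (rule reachable_mono[rotated]) auto
  moreover have "(p, q) \<in> reachable (insert {p, q} E)" by (rule reachable_edge) simp
  ultimately show "?R \<Longrightarrow> ?L" by (meson reachable_sym reachable_trans)
qed

section \<open>Paths and cycles\<close>

lemma reachable_imp_distinct_path:
  assumes "(x, y) \<in> reachable E"
  obtains vs where "vs \<noteq> []" "hd vs = x" "last vs = y" "distinct vs"
    "successively (\<lambda>u v. {u, v} \<in> E) vs"
proof -
  have "\<exists>vs. vs \<noteq> [] \<and> hd vs = x \<and> last vs = y \<and> distinct vs \<and> successively (\<lambda>u v. {u, v} \<in> E) vs"
    using assms unfolding reachable_def
  proof (induction rule: converse_rtrancl_induct)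
    case base
    show ?case by (intro exI[of _ "[y]"]) simp
  next
    case (step x z)
    then obtain vs where vs: "vs \<noteq> []" "hd vs = z" "last vs = y" "distinct vs"
      "successively (\<lambda>u v. {u, v} \<in> E) vs" by blast
    show ?case
    proof (cases "x \<in> set vs")
      case True
      \<comment> \<open>The new vertex already lies on the path, so the suffix starting there is
        used and no vertex is repeated.\<close>
      then obtain us ws where "vs = us @ x # ws" by (meson split_list)
      with vs show ?thesis
        by (intro exI[of _ "x # ws"]) (auto simp: successively_append_iff)
    next
      case False
      with vs step(1) show ?thesis
        by (intro exI[of _ "x # vs"]) (auto simp: successively_Cons)
    qed
  qed
  then show ?thesis using that by blast
qed

lemma successively_imp_reachable:
  "successively (\<lambda>u v. {u, v} \<in> E) vs \<Longrightarrow> vs \<noteq> [] \<Longrightarrow> (hd vs, last vs) \<in> reachable E"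
proof (induction vs)
  case (Cons x vs)
  then show ?case
    using reachable_trans[OF reachable_edge] by (cases vs) (simp, fastforce)
qed simp

text \<open>A cycle without its closing edge is a detour around that edge, which is then no bridge.
  Conversely, a path with distinct vertices that avoids an edge but joins its ends closes up to a
  cycle.\<close>

lemma forest_iff_no_cycle: "forest E \<longleftrightarrow> (\<nexists>vs. is_cycle E vs)"
proof
  assume f: "forest E"
  show "\<nexists>vs. is_cycle E vs"
  proof
    assume "\<exists>vs. is_cycle E vs"
    then obtain vs where vs: "3 \<le> length vs" "distinct vs"
      "successively (\<lambda>x y. {x, y} \<in> E) vs" "{last vs, hd vs} \<in> E"
      by (auto simp: is_cycle_def)
    then obtain x y z ws where vs_eq: "vs = x # y # z # ws"
      unfolding numeral_3_eq_3 by (metis Suc_le_length_iff)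
    define l where "l = last vs"
    have l: "l \<in> set (z # ws)" by (simp add: vs_eq l_def)
    have x: "x \<notin> set (y # z # ws)" and y: "y \<notin> set (z # ws)" using vs(2) by (auto simp: vs_eq)
    have "successively (\<lambda>u v. {u, v} \<in> E - {{l, x}}) (y # z # ws)"
    proof (rule successively_mono[where P = "\<lambda>x y. {x, y} \<in> E"])
      show "successively (\<lambda>x y. {x, y} \<in> E) (y # z # ws)"
        using vs(3) by (simp add: vs_eq)
      fix u v assume "u \<in> set (y # z # ws)" "v \<in> set (y # z # ws)" "{u, v} \<in> E"
      then show "{u, v} \<in> E - {{l, x}}" using x by (auto simp: doubleton_eq_iff)
    qed
    \<comment> \<open>Here the length of the cycle matters: with three distinct vertices
      \<open>l\<close> differs from \<open>y\<close>, so the first edge is not the closing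
      one.\<close>
    moreover have "{x, y} \<in> E - {{l, x}}"
      using vs(3) l y x by (auto simp: vs_eq doubleton_eq_iff)
    ultimately have "successively (\<lambda>u v. {u, v} \<in> E - {{l, x}}) vs" by (simp add: vs_eq)
    from successively_imp_reachable[OF this] have "(x, l) \<in> reachable (E - {{l, x}})"
      by (simp add: vs_eq l_def)
    moreover have "l \<noteq> x" using l x by auto
    moreover have "{l, x} \<in> E" using vs(4) by (simp add: l_def vs_eq)
    ultimately show False using f reachable_sym[of x l] unfolding forest_def by blast
  qed
next
  assume no: "\<nexists>vs. is_cycle E vs"
  show "forest E"
    unfolding forest_def
  proof (intro allI impI notI)
    fix x y assume xy: "x \<noteq> y" "{x, y} \<in> E" and "(x, y) \<in> reachable (E - {{x, y}})"
    then obtain vs where vs: "vs \<noteq> []" "hd vs = x" "last vs = y" "distinct vs"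
      and s: "successively (\<lambda>u v. {u, v} \<in> E - {{x, y}}) vs"
      by (elim reachable_imp_distinct_path)
    obtain u ws where 1: "vs = x # u # ws"
      using vs xy by (metis hd_Cons_tl last_ConsL)
    \<comment> \<open>A path with two vertices would be the edge \<open>{x, y}\<close> itself, which
      \<open>s\<close> excludes.\<close>
    obtain v ws' where 2: "ws = v # ws'"
      using vs xy s 1 by (cases ws) auto
    have "successively (\<lambda>u v. {u, v} \<in> E) vs"
      using s by (rule successively_mono) auto
    then have "is_cycle E vs"
      using vs xy 1 2 by (simp add: is_cycle_def insert_commute)
    then show False using no by blast
  qed
qed

lemma forest_not_reachable:
  assumes "forest T" "F \<subseteq> T" "{p, q} \<in> T - F" "p \<noteq> q"
  shows "(p, q) \<notin> reachable F"
proof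
  assume "(p, q) \<in> reachable F"
  then have "(p, q) \<in> reachable (T - {{p, q}})"
    by (rule reachable_mono[rotated]) (use assms in blast)
  then show False using assms unfolding forest_def by blast
qed

text \<open>If an old edge \<open>{x, y}\<close> stopped being a bridge, its detour would have to
  cross the new edge. Together with \<open>{x, y}\<close> the rest of the detour would then connect
  \<open>p\<close> to \<open>q\<close> inside \<open>F\<close>.\<close>

lemma forest_insert:
  assumes F: "forest F" and pq: "(p, q) \<notin> reachable F"
  shows "forest (insert {p, q} F)"
  unfolding forest_def
proof (intro allI impI notI)
  fix x y assume xy: "x \<noteq> y" "{x, y} \<in> insert {p, q} F"
    and r: "(x, y) \<in> reachable (insert {p, q} F - {{x, y}})"
  show False
  proof (cases "{x, y} = {p, q}")
    case True
    then have "(x, y) \<in> reachable F" using r by (elim reachable_mono[rotated]) auto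
    then show False using pq True reachable_sym[of q p F] by (auto simp: doubleton_eq_iff)
  next
    case False
    then have "{x, y} \<in> F" using xy by auto
    have eq: "insert {p, q} F - {{x, y}} = insert {p, q} (F - {{x, y}})" using False by auto
    have nxy: "(x, y) \<notin> reachable (F - {{x, y}})" using F xy \<open>{x, y} \<in> F\<close> by (auto simp: forest_def)
    have sub: "(u, v) \<in> reachable F" if "(u, v) \<in> reachable (F - {{x, y}})" for u v
      using that by (rule reachable_mono[rotated]) auto
    from r[unfolded eq reachable_insert] nxy show False
      using sub reachable_edge[OF \<open>{x, y} \<in> F\<close>] pq by (meson reachable_sym reachable_trans)
  qed
qed

lemma spanning_trees_iff:
  "T \<in> spanning_trees V \<longleftrightarrow> T \<subseteq> complete_edges V \<and> V \<times> V \<subseteq> reachable T \<and> forest T"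
  by (auto simp: spanning_trees_def connected_edges_def forest_iff_no_cycle reachable_def)

section \<open>Components and their merging\<close>

definition forest_components :: "'v set \<Rightarrow> 'v set set \<Rightarrow> 'v set set" where
  "forest_components V F = (\<lambda>x. reachable F `` {x}) ` V"

lemma reachable_in_carrier:
  assumes "F \<subseteq> complete_edges V" "(x, y) \<in> reachable F" "x \<in> V"
  shows "y \<in> V"
  using assms(2,3) unfolding reachable_def
  by (induction rule: rtrancl_induct) (use assms(1) in \<open>auto simp: complete_edges_def doubleton_eq_iff\<close>)

lemma component_subset: "F \<subseteq> complete_edges V \<Longrightarrow> x \<in> V \<Longrightarrow> reachable F `` {x} \<subseteq> V"
  using reachable_in_carrier[of F V x] by blast

lemma component_eq_iff: "reachable F `` {x} = reachable F `` {y} \<longleftrightarrow> (x, y) \<in> reachable F"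
  using equiv_reachable by (metis UNIV_I eq_equiv_class_iff)

lemma component_insert:
  assumes "x \<in> reachable F `` {p} \<union> reachable F `` {q}"
  shows "reachable (insert {p, q} F) `` {x} = reachable F `` {p} \<union> reachable F `` {q}"
proof (intro set_eqI)
  fix y
  have eq: "(x, y) \<in> reachable F \<longleftrightarrow> (z, y) \<in> reachable F" if "(z, x) \<in> reachable F" for z
    using that by (meson reachable_sym reachable_trans)
  from assms consider "(p, x) \<in> reachable F" | "(q, x) \<in> reachable F" by auto
  then show "y \<in> reachable (insert {p, q} F) `` {x} \<longleftrightarrow> y \<in> reachable F `` {p} \<union> reachable F `` {q}"
  proof cases
    case 1
    then show ?thesis using reachable_sym[OF 1] eq[OF 1] by (auto simp: reachable_insert)
  next
    case 2
    then show ?thesis using reachable_sym[OF 2] eq[OF 2] by (auto simp: reachable_insert)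
  qed
qed

lemma component_insert_other:
  assumes "x \<notin> reachable F `` {p} \<union> reachable F `` {q}"
  shows "reachable (insert {p, q} F) `` {x} = reachable F `` {x}"
  using assms reachable_sym[of x p F] reachable_sym[of x q F] by (auto simp: reachable_insert)

lemma components_insert:
  assumes "p \<in> V" "q \<in> V"
  shows "forest_components V (insert {p, q} F) =
    insert (reachable F `` {p} \<union> reachable F `` {q})
      (forest_components V F - {reachable F `` {p}, reachable F `` {q}})" (is "_ = insert ?U ?rest")
proof -
  have rest: "?rest = (\<lambda>x. reachable F `` {x}) ` (V - ?U)"
  proof -
    have "x \<in> ?U \<longleftrightarrow> reachable F `` {x} = reachable F `` {p} \<or> reachable F `` {x} = reachable F `` {q}" for x
      by (metis component_eq_iff Un_iff Image_singleton_iff)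
    then show ?thesis unfolding forest_components_def by blast
  qed
  have "V = (V \<inter> ?U) \<union> (V - ?U)" by blast
  then have "forest_components V (insert {p, q} F) =
      (\<lambda>x. reachable (insert {p, q} F) `` {x}) ` (V \<inter> ?U) \<union>
      (\<lambda>x. reachable (insert {p, q} F) `` {x}) ` (V - ?U)"
    unfolding forest_components_def by (metis image_Un)
  also have "(\<lambda>x. reachable (insert {p, q} F) `` {x}) ` (V - ?U) = ?rest"
    unfolding rest by (intro image_cong) (auto simp: component_insert_other)
  also have "(\<lambda>x. reachable (insert {p, q} F) `` {x}) ` (V \<inter> ?U) = (\<lambda>x. ?U) ` (V \<inter> ?U)"
    by (rule image_cong[OF refl]) (rule component_insert, simp)
  also have "\<dots> = {?U}"
  proof (rule image_constant)
    show "p \<in> V \<inter> ?U" using assms by simp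
  qed
  finally show ?thesis by (rule trans) (rule insert_is_Un[symmetric])
qed

text \<open>A class containing both \<open>p\<close> and \<open>q\<close> would connect them. Hence
  merging inserts a new element, and cardinalities and products over components change in a
  controlled way.\<close>

lemma union_notin_components:
  assumes "(p, q) \<notin> reachable F"
  shows "reachable F `` {p} \<union> reachable F `` {q} \<notin> forest_components V F"
proof
  assume "reachable F `` {p} \<union> reachable F `` {q} \<in> forest_components V F"
  then obtain x where x: "reachable F `` {p} \<union> reachable F `` {q} = reachable F `` {x}"
    by (auto simp: forest_components_def)
  have "p \<in> reachable F `` {p}" "q \<in> reachable F `` {q}" by simp_all
  then have "p \<in> reachable F `` {x}" "q \<in> reachable F `` {x}"
    unfolding x[symmetric] by (simp_all only: Un_iff simp_thms)
  then have "(x, p) \<in> reachable F" "(x, q) \<in> reachable F" by simp_all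
  then show False using assms by (meson reachable_sym reachable_trans)
qed

lemma card_components_insert:
  assumes "finite V" "p \<in> V" "q \<in> V" "(p, q) \<notin> reachable F"
  shows "card (forest_components V F) = Suc (card (forest_components V (insert {p, q} F)))"
proof -
  let ?p = "reachable F `` {p}" and ?q = "reachable F `` {q}"
  have fin: "finite (forest_components V F)" using assms by (simp add: forest_components_def)
  have in_comp: "{?p, ?q} \<subseteq> forest_components V F" using assms by (auto simp: forest_components_def)
  have "?p \<noteq> ?q" using assms(4) component_eq_iff by metis
  then have "card (forest_components V F - {?p, ?q}) = card (forest_components V F) - 2"
    using card_Diff_subset[of "{?p, ?q}" "forest_components V F"] in_comp by simp
  moreover have "2 \<le> card (forest_components V F)"
    using card_mono[OF fin in_comp] \<open>?p \<noteq> ?q\<close> by simp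
  ultimately show ?thesis
    using union_notin_components[OF assms(4), of V] fin assms
    by (simp add: components_insert)
qed

text \<open>Stated without division, so that \<open>f\<close> may take the value zero.\<close>

lemma prod_components_insert:
  fixes f :: "'v set \<Rightarrow> real"
  assumes "finite V" "p \<in> V" "q \<in> V" "(p, q) \<notin> reachable F"
  shows "(\<Prod>C\<in>forest_components V (insert {p, q} F). f C) * (f (reachable F `` {p}) * f (reachable F `` {q}))
    = (\<Prod>C\<in>forest_components V F. f C) * f (reachable F `` {p} \<union> reachable F `` {q})"
proof -
  let ?p = "reachable F `` {p}" and ?q = "reachable F `` {q}"
  have fin: "finite (forest_components V F)" using assms by (simp add: forest_components_def)
  have in_comp: "{?p, ?q} \<subseteq> forest_components V F" using assms by (auto simp: forest_components_def)
  have ne: "?p \<noteq> ?q" using assms(4) component_eq_iff by metis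
  have "(\<Prod>C\<in>forest_components V F. f C) = (\<Prod>C\<in>forest_components V F - {?p, ?q}. f C) * (f ?p * f ?q)"
    using prod.subset_diff[OF in_comp fin, of f] ne by simp
  then show ?thesis
    using union_notin_components[OF assms(4), of V] fin assms by (simp add: components_insert)
qed

section \<open>Spanning trees containing a forest\<close>

lemma card_ordered_pairs:
  assumes "finite E" "E \<subseteq> complete_edges V"
  shows "finite {(p, q). {p, q} \<in> E} \<and> card {(p, q). {p, q} \<in> E} = 2 * card E"
  using assms
proof (induction E)
  case (insert e E)
  obtain x y where e: "e = {x, y}" "x \<noteq> y"
    using insert.prems by (auto simp: complete_edges_def)
  have "{(p, q). {p, q} \<in> insert e E} = insert (x, y) (insert (y, x) {(p, q). {p, q} \<in> E})"
    unfolding e by (auto simp: doubleton_eq_iff)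
  moreover have "(x, y) \<notin> insert (y, x) {(p, q). {p, q} \<in> E}" "(y, x) \<notin> {(p, q). {p, q} \<in> E}"
    using insert.hyps e by (auto simp: insert_commute)
  ultimately show ?case using insert by simp
qed simp

section \<open>Weighted tree sums over the complete graph\<close>

locale weighted_clique =
  fixes V :: "'v set" and c :: "'v \<Rightarrow> real"
  assumes finite_V: "finite V" and V_nonempty: "V \<noteq> {}" and c_pos: "\<And>p. p \<in> V \<Longrightarrow> 0 < c p"
begin

definition weight :: "'v set \<Rightarrow> real" where
  "weight e = prod c e / sum c V"

definition trees_over :: "'v set set \<Rightarrow> 'v set set set" where
  "trees_over F = {T \<in> spanning_trees V. F \<subseteq> T}"

text \<open>The weighted tree sum of the graph with \<open>F\<close> contracted: edges of
  \<open>F\<close> contribute no factor, so a tree \<open>F\<close> has value 1.\<close>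

definition completions :: "'v set set \<Rightarrow> real" where
  "completions F = (\<Sum>T\<in>trees_over F. \<Prod>e\<in>T - F. weight e)"

definition mass :: "'v set set \<Rightarrow> 'v \<Rightarrow> real" where
  "mass F p = sum c (reachable F `` {p})"

lemma total_pos: "0 < sum c V"
  using finite_V V_nonempty c_pos by (rule sum_pos)

lemma finite_trees_over: "finite (trees_over F)"
  using finite_spanning_trees[OF finite_V] by (simp add: trees_over_def)

lemma tree_subset: "T \<in> spanning_trees V \<Longrightarrow> T \<subseteq> complete_edges V"
  by (simp add: spanning_trees_def)

lemma finite_tree: "T \<in> spanning_trees V \<Longrightarrow> finite T"
  by (meson finite_V finite_complete_edges finite_subset tree_subset)

lemma edge_iff: "{p, q} \<in> complete_edges V \<longleftrightarrow> p \<in> V \<and> q \<in> V \<and> p \<noteq> q"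
  by (auto simp: complete_edges_def doubleton_eq_iff)

lemma weight_edge: "p \<noteq> q \<Longrightarrow> weight {p, q} = c p * c q / sum c V"
  by (simp add: weight_def)

lemma weight_pos: "e \<in> complete_edges V \<Longrightarrow> 0 < weight e"
  using total_pos by (auto simp: complete_edges_def weight_def c_pos intro!: divide_pos_pos)

lemma mass_pos:
  assumes "F \<subseteq> complete_edges V" "p \<in> V"
  shows "0 < mass F p"
  unfolding mass_def
proof (rule sum_pos)
  show "finite (reachable F `` {p})"
    using component_subset[OF assms] finite_V by (rule finite_subset)
  show "reachable F `` {p} \<noteq> {}" using reachable_refl[of p F] by blast
  show "0 < c i" if "i \<in> reachable F `` {p}" for i
    using that component_subset[OF assms] c_pos by blast
qed

lemma components_tree:
  assumes "T \<in> spanning_trees V"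
  shows "forest_components V T = {V}"
proof -
  have "reachable T `` {x} = V" if "x \<in> V" for x
    using component_subset[OF tree_subset[OF assms] that] assms that
    unfolding spanning_trees_iff by blast
  then show ?thesis using V_nonempty unfolding forest_components_def by auto
qed

text \<open>Each edge of \<open>T - F\<close> joins two different components when it is added, and
  the process ends with the single component \<open>V\<close>.\<close>

lemma card_components:
  assumes T: "T \<in> spanning_trees V" and F: "F \<subseteq> T"
  shows "card (forest_components V F) = Suc (card (T - F))"
  using F
proof (induction "card (T - F)" arbitrary: F)
  case 0
  then have "F = T" using finite_tree[OF T] by (metis card_0_eq finite_Diff Diff_eq_empty_iff subset_antisym)
  then show ?case by (simp add: components_tree[OF T])
next
  case (Suc n)
  then obtain e where e: "e \<in> T - F" by (metis card.empty ex_in_conv nat.simps(3))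
  then obtain p q where pq: "e = {p, q}" "p \<in> V" "q \<in> V" "p \<noteq> q"
    using tree_subset[OF T] by (auto simp: complete_edges_def)
  have nr: "(p, q) \<notin> reachable F"
    using T e pq Suc.prems by (intro forest_not_reachable[of T]) (auto simp: spanning_trees_iff)
  have "T - insert e F = (T - F) - {e}" by auto
  then have "card (T - insert e F) = n"
    using Suc.hyps(2) e finite_tree[OF T] by simp
  with Suc e have "card (forest_components V (insert e F)) = Suc n" by auto
  then show ?case
    using card_components_insert[OF finite_V pq(2,3) nr] Suc.hyps(2) by (simp add: pq(1))
qed

text \<open>Within one component the fractions add up to 1, so the sum counts components.\<close>

lemma sum_over_mass:
  assumes F: "F \<subseteq> complete_edges V"
  shows "(\<Sum>p\<in>V. c p / mass F p) = card (forest_components V F)"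
proof -
  have "(\<Sum>p\<in>V. c p / mass F p) =
      (\<Sum>C\<in>forest_components V F. \<Sum>p | p \<in> V \<and> reachable F `` {p} = C. c p / mass F p)"
    unfolding forest_components_def by (rule sum.image_gen[OF finite_V])
  also have "\<dots> = (\<Sum>C\<in>forest_components V F. 1)"
  proof (rule sum.cong[OF refl])
    fix C assume "C \<in> forest_components V F"
    then obtain x where x: "x \<in> V" "C = reachable F `` {x}" by (auto simp: forest_components_def)
    have "{p \<in> V. reachable F `` {p} = C} = C"
      using component_subset[OF F x(1)] reachable_sym[of _ _ F]
      unfolding x(2) component_eq_iff by blast
    then have "(\<Sum>p | p \<in> V \<and> reachable F `` {p} = C. c p / mass F p) = (\<Sum>p\<in>C. c p / sum c C)"
      by (intro sum.cong) (auto simp: mass_def)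
    also have "\<dots> = 1"
      using mass_pos[OF F x(1)] by (simp add: sum_divide_distrib[symmetric] mass_def x(2))
    finally show "(\<Sum>p | p \<in> V \<and> reachable F `` {p} = C. c p / mass F p) = 1" .
  qed
  finally show ?thesis by simp
qed

text \<open>Swapping \<open>p\<close> and \<open>q\<close> exchanges the two halves, so one of them
  suffices. For fixed \<open>p\<close> the vertices \<open>q\<close> outside its component have
  total conductance \<open>sum c V - mass F p\<close>, and \<open>sum_over_mass\<close> finishes the
  sum over \<open>p\<close>.\<close>

lemma sum_over_separated_pairs:
  assumes F: "F \<subseteq> complete_edges V"
  shows "(\<Sum>(p, q) | p \<in> V \<and> q \<in> V \<and> (p, q) \<notin> reachable F. c p * c q * (1 / mass F p + 1 / mass F q))
    = 2 * sum c V * (real (card (forest_components V F)) - 1)"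
proof -
  let ?R = "{(p, q). p \<in> V \<and> q \<in> V \<and> (p, q) \<notin> reachable F}"
  have R: "?R = (SIGMA p:V. V - reachable F `` {p})" by auto
  have half: "(\<Sum>(p, q)\<in>?R. c p * c q / mass F p) = sum c V * (real (card (forest_components V F)) - 1)"
  proof -
    have "(\<Sum>(p, q)\<in>?R. c p * c q / mass F p) =
        (\<Sum>p\<in>V. \<Sum>q\<in>V - reachable F `` {p}. c p * c q / mass F p)"
      unfolding R using finite_V by (intro sum.Sigma[symmetric]) auto
    also have "\<dots> = (\<Sum>p\<in>V. c p / mass F p * sum c V - c p)"
    proof (rule sum.cong[OF refl])
      fix p assume p: "p \<in> V"
      have "(\<Sum>q\<in>V - reachable F `` {p}. c p * c q / mass F p)
          = c p / mass F p * (\<Sum>q\<in>V - reachable F `` {p}. c q)"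
        by (simp add: sum_distrib_left)
      also have "(\<Sum>q\<in>V - reachable F `` {p}. c q) = sum c V - mass F p"
        unfolding mass_def by (rule sum_diff[OF finite_V component_subset[OF F p]])
      also have "c p / mass F p * (sum c V - mass F p) = c p / mass F p * sum c V - c p"
        using mass_pos[OF F p] by (simp add: field_simps)
      finally show "(\<Sum>q\<in>V - reachable F `` {p}. c p * c q / mass F p)
          = c p / mass F p * sum c V - c p" .
    qed
    also have "\<dots> = sum c V * (real (card (forest_components V F)) - 1)"
      unfolding sum_subtractf sum_distrib_right[symmetric] sum_over_mass[OF F]
      by (simp add: algebra_simps)
    finally show ?thesis .
  qed
  have "(\<Sum>(p, q)\<in>?R. c p * c q / mass F q) = (\<Sum>(p, q)\<in>?R. c p * c q / mass F p)"
    by (rule sum.reindex_bij_witness[of _ "\<lambda>(p, q). (q, p)" "\<lambda>(p, q). (q, p)"])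
      (auto dest: reachable_sym)
  then show ?thesis
    using half by (simp add: distrib_left sum.distrib case_prod_unfold)
qed

text \<open>Merging components of masses \<open>m\<close> and \<open>n\<close> replaces the factor
  \<open>m * n\<close> by \<open>m + n\<close>, which is
  \<open>m * n * (1 / m + 1 / n)\<close>.\<close>

lemma prod_mass_insert:
  assumes F: "F \<subseteq> complete_edges V" and pq: "p \<in> V" "q \<in> V" "(p, q) \<notin> reachable F"
  shows "(\<Prod>C\<in>forest_components V (insert {p, q} F). sum c C)
    = (\<Prod>C\<in>forest_components V F. sum c C) * (1 / mass F p + 1 / mass F q)"
proof -
  have "reachable F `` {p} \<inter> reachable F `` {q} = {}"
    using pq(3) by (auto dest: reachable_sym reachable_trans)
  moreover have "finite (reachable F `` {p})" "finite (reachable F `` {q})"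
    using component_subset[OF F] pq finite_V by (auto intro: finite_subset)
  ultimately have "sum c (reachable F `` {p} \<union> reachable F `` {q}) = mass F p + mass F q"
    unfolding mass_def by (intro sum.union_disjoint)
  then show ?thesis
    using prod_components_insert[OF finite_V pq, of "sum c"] mass_pos[OF F pq(1)] mass_pos[OF F pq(2)]
    by (simp add: mass_def[symmetric] field_simps)
qed

text \<open>Double counting of the pairs of a tree \<open>T \<supseteq> F\<close> and an edge of \<open>T - F\<close>; both orientations of the
  edge are counted, whence the factor 2.\<close>

lemma completions_recursion:
  assumes F: "F \<subseteq> complete_edges V"
  shows "2 * (real (card (forest_components V F)) - 1) * completions F =
    (\<Sum>(p, q) | p \<in> V \<and> q \<in> V \<and> (p, q) \<notin> reachable F.
       weight {p, q} * completions (insert {p, q} F))"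
proof -
  let ?R = "{(p, q). p \<in> V \<and> q \<in> V \<and> (p, q) \<notin> reachable F}"
  have finR: "finite ?R" by (rule finite_subset[of _ "V \<times> V"]) (use finite_V in auto)
  \<comment> \<open>By \<open>card_components\<close> the factor on the left is twice the number of
    edges of \<open>T - F\<close>, the same number for every tree over \<open>F\<close>.\<close>
  have tree: "2 * (real (card (forest_components V F)) - 1) * (\<Prod>e\<in>T - F. weight e) =
      (\<Sum>(p, q)\<in>?R. if {p, q} \<in> T then weight {p, q} * (\<Prod>e\<in>T - insert {p, q} F. weight e) else 0)"
    if T: "T \<in> trees_over F" for T
  proof -
    have T': "T \<in> spanning_trees V" "F \<subseteq> T" using T by (auto simp: trees_over_def)
    have fin: "finite (T - F)" using finite_tree[OF T'(1)] by simp
    have sub: "T - F \<subseteq> complete_edges V" using tree_subset[OF T'(1)] by blast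
    have inR: "(p, q) \<in> ?R \<and> {p, q} \<in> T \<longleftrightarrow> {p, q} \<in> T - F" for p q
    proof (intro iffI conjI)
      assume "(p, q) \<in> ?R \<and> {p, q} \<in> T"
      then show "{p, q} \<in> T - F" using reachable_edge[of p q F] by auto
    next
      assume pq: "{p, q} \<in> T - F"
      then have "p \<in> V" "q \<in> V" "p \<noteq> q" using sub edge_iff by blast+
      moreover have "(p, q) \<notin> reachable F"
        using T' pq \<open>p \<noteq> q\<close> by (intro forest_not_reachable[of T]) (auto simp: spanning_trees_iff)
      ultimately show "(p, q) \<in> ?R" by simp
    qed simp
    have "(\<Sum>(p, q)\<in>?R. if {p, q} \<in> T then weight {p, q} * (\<Prod>e\<in>T - insert {p, q} F. weight e) else 0)
      = (\<Sum>x\<in>?R. if {fst x, snd x} \<in> T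
           then weight {fst x, snd x} * (\<Prod>e\<in>T - insert {fst x, snd x} F. weight e) else 0)"
      by (simp add: case_prod_unfold)
    also have "\<dots> = (\<Sum>x\<in>{x\<in>?R. {fst x, snd x} \<in> T}.
         weight {fst x, snd x} * (\<Prod>e\<in>T - insert {fst x, snd x} F. weight e))"
      by (rule sum.inter_filter[OF finR, symmetric])
    also have "\<dots> = (\<Sum>x\<in>{x\<in>?R. {fst x, snd x} \<in> T}. \<Prod>e\<in>T - F. weight e)"
    proof (rule sum.cong[OF refl])
      fix x assume "x \<in> {x\<in>?R. {fst x, snd x} \<in> T}"
      then have "{fst x, snd x} \<in> T - F" using inR[of "fst x" "snd x"] by simp
      from prod.remove[OF fin this, of weight]
      show "weight {fst x, snd x} * (\<Prod>e\<in>T - insert {fst x, snd x} F. weight e) = (\<Prod>e\<in>T - F. weight e)"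
        unfolding Diff_insert[of T _ F] by (rule sym)
    qed
    also have "{x\<in>?R. {fst x, snd x} \<in> T} = {(p, q). {p, q} \<in> T - F}"
    proof (rule set_eqI)
      fix x
      show "x \<in> {x\<in>?R. {fst x, snd x} \<in> T} \<longleftrightarrow> x \<in> {(p, q). {p, q} \<in> T - F}"
        using inR[of "fst x" "snd x"]
        by (cases x) (simp only: mem_Collect_eq case_prod_conv fst_conv snd_conv)
    qed
    also have "(\<Sum>x\<in>{(p, q). {p, q} \<in> T - F}. \<Prod>e\<in>T - F. weight e)
        = real (2 * card (T - F)) * (\<Prod>e\<in>T - F. weight e)"
      using card_ordered_pairs[OF fin sub] by simp
    finally show ?thesis using card_components[OF T'] by simp
  qed
  have "2 * (real (card (forest_components V F)) - 1) * completions F =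
      (\<Sum>T\<in>trees_over F. \<Sum>(p, q)\<in>?R.
         if {p, q} \<in> T then weight {p, q} * (\<Prod>e\<in>T - insert {p, q} F. weight e) else 0)"
    unfolding completions_def sum_distrib_left by (intro sum.cong[OF refl] tree)
  also have "\<dots> = (\<Sum>(p, q)\<in>?R. \<Sum>T\<in>trees_over F.
         if {p, q} \<in> T then weight {p, q} * (\<Prod>e\<in>T - insert {p, q} F. weight e) else 0)"
    unfolding case_prod_unfold by (rule sum.swap)
  also have "\<dots> = (\<Sum>(p, q)\<in>?R. weight {p, q} * completions (insert {p, q} F))"
  proof (intro sum.cong[OF refl], clarify)
    fix p q
    have "trees_over (insert {p, q} F) = {T\<in>trees_over F. {p, q} \<in> T}"
      by (auto simp: trees_over_def)
    then show "(\<Sum>T\<in>trees_over F.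
         if {p, q} \<in> T then weight {p, q} * (\<Prod>e\<in>T - insert {p, q} F. weight e) else 0)
       = weight {p, q} * completions (insert {p, q} F)"
      unfolding completions_def sum_distrib_left
      by (simp add: sum.inter_filter[OF finite_trees_over])
  qed
  finally show ?thesis .
qed

text \<open>For empty \<open>F\<close> this is a weighted Cayley formula. With one component,
  \<open>F\<close> is the only tree over itself and both sides are the total conductance. Otherwise
  the recursion leads to forests with one component fewer, and
  \<open>sum_over_separated_pairs\<close> evaluates the resulting sum.\<close>

lemma completions_eq:
  assumes "F \<subseteq> complete_edges V" "forest F"
  shows "sum c V * completions F = (\<Prod>C\<in>forest_components V F. sum c C)"
  using assms
proof (induction "card (forest_components V F)" arbitrary: F rule: less_induct)
  case less
  note F = less.prems(1)
  let ?k = "card (forest_components V F)" and ?G = "\<Prod>C\<in>forest_components V F. sum c C"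
  have fin: "finite (forest_components V F)" using finite_V by (simp add: forest_components_def)
  have "?k \<noteq> 0" using V_nonempty fin by (simp add: forest_components_def)
  then consider "?k = 1" | "1 < ?k" by linarith
  then show ?case
  proof cases
    case 1
    have "V \<times> V \<subseteq> reachable F"
    proof (clarify)
      fix x y assume "x \<in> V" "y \<in> V"
      then have "reachable F `` {x} \<in> forest_components V F" "reachable F `` {y} \<in> forest_components V F"
        by (auto simp: forest_components_def)
      then have "reachable F `` {x} = reachable F `` {y}"
        using 1 by (metis card_1_singletonE singletonD)
      then show "(x, y) \<in> reachable F" by (simp only: component_eq_iff)
    qed
    then have tree: "F \<in> spanning_trees V" using less.prems by (simp add: spanning_trees_iff)
    have "T = F" if "T \<in> trees_over F" for T
    proof -
      have T: "T \<in> spanning_trees V" "F \<subseteq> T" using that by (auto simp: trees_over_def)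
      then have "T - F = {}" using card_components[OF T] 1 finite_tree[OF T(1)] by simp
      then show ?thesis using T(2) by blast
    qed
    then have "trees_over F = {F}" using tree by (auto simp: trees_over_def)
    then show ?thesis by (simp add: completions_def components_tree[OF tree])
  next
    case 2
    let ?R = "{(p, q). p \<in> V \<and> q \<in> V \<and> (p, q) \<notin> reachable F}"
    \<comment> \<open>One factor \<open>sum c V\<close> clears the denominator of the edge weight;
      the other brings in the induction hypothesis.\<close>
    have step: "weight {p, q} * completions (insert {p, q} F) * (sum c V * sum c V)
        = ?G * (c p * c q * (1 / mass F p + 1 / mass F q))"
      if pq: "p \<in> V" "q \<in> V" "(p, q) \<notin> reachable F" for p q
    proof -
      have "p \<noteq> q" using pq(3) by auto
      have "sum c V * completions (insert {p, q} F) = ?G * (1 / mass F p + 1 / mass F q)"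
        unfolding prod_mass_insert[OF F pq, symmetric]
      proof (rule less.hyps)
        show "card (forest_components V (insert {p, q} F)) < ?k"
          using card_components_insert[OF finite_V pq] by simp
        show "insert {p, q} F \<subseteq> complete_edges V"
          using F pq \<open>p \<noteq> q\<close> by (simp add: edge_iff)
        show "forest (insert {p, q} F)" using less.prems(2) pq(3) by (rule forest_insert)
      qed
      moreover have "weight {p, q} * sum c V = c p * c q"
        using weight_edge[OF \<open>p \<noteq> q\<close>] total_pos by simp
      ultimately have "(weight {p, q} * sum c V) * (sum c V * completions (insert {p, q} F))
          = (c p * c q) * (?G * (1 / mass F p + 1 / mass F q))"
        by (simp only:)
      then show ?thesis by (simp only: mult_ac)
    qed
    have "2 * (real ?k - 1) * completions F * (sum c V * sum c V) =
        (\<Sum>(p, q)\<in>?R. ?G * (c p * c q * (1 / mass F p + 1 / mass F q)))"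
      unfolding completions_recursion[OF F] sum_distrib_right[where A = ?R]
      by (intro sum.cong[OF refl]) (use step in auto)
    also have "\<dots> = ?G * (2 * sum c V * (real ?k - 1))"
      unfolding sum_over_separated_pairs[OF F, symmetric] by (simp add: sum_distrib_left case_prod_unfold)
    finally have "(2 * (real ?k - 1) * sum c V) * (sum c V * completions F) =
        (2 * (real ?k - 1) * sum c V) * ?G"
      by (simp add: mult_ac)
    \<comment> \<open>There are at least two components, so the common factor cancels.\<close>
    moreover have "2 * (real ?k - 1) * sum c V \<noteq> 0" using 2 total_pos by simp
    ultimately show ?thesis by (simp only: mult_cancel_left simp_thms)
  qed
qed

end

section \<open>Edge correlations\<close>

lemma power2_norm_sum_scaleR:
  fixes u :: "'a \<Rightarrow> 'b::real_inner"
  shows "(norm (\<Sum>e\<in>D. x e *\<^sub>R u e))\<^sup>2 = (\<Sum>e\<in>D. \<Sum>f\<in>D. x e * x f * (u e \<bullet> u f))"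
  unfolding power2_norm_eq_inner inner_sum_left by (simp add: inner_sum_right sum_distrib_left mult_ac)

context weighted_clique
begin

definition tree_law :: "'v set set pmf" where
  "tree_law = random_spanning_tree V weight"

definition prob_over :: "'v set set \<Rightarrow> real" where
  "prob_over F = (\<Sum>T\<in>trees_over F. pmf tree_law T)"

lemma set_tree_law: "set_pmf tree_law = spanning_trees V"
  unfolding tree_law_def
  by (rule set_pmf_random_spanning_tree[OF finite_V V_nonempty weight_pos])

lemma expectation_tree_law:
  fixes f :: "'v set set \<Rightarrow> 'b::{banach, second_countable_topology}"
  shows "measure_pmf.expectation tree_law f = (\<Sum>T\<in>spanning_trees V. pmf tree_law T *\<^sub>R f T)"
  by (rule integral_measure_pmf) (auto simp: finite_spanning_trees finite_V set_tree_law)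

lemma sum_pmf_tree_law: "(\<Sum>T\<in>spanning_trees V. pmf tree_law T) = 1"
  by (rule sum_pmf_eq_1) (auto simp: finite_spanning_trees finite_V set_tree_law)

lemma prob_over_empty: "prob_over {} = 1"
  by (simp add: prob_over_def trees_over_def sum_pmf_tree_law)

lemma prob_over_eq_sum:
  "prob_over F = (\<Sum>T\<in>spanning_trees V. pmf tree_law T * of_bool (F \<subseteq> T))"
proof -
  have "(\<Sum>T\<in>spanning_trees V. pmf tree_law T * of_bool (F \<subseteq> T))
      = (\<Sum>T\<in>spanning_trees V. if F \<subseteq> T then pmf tree_law T else 0)"
    by (intro sum.cong) auto
  then show ?thesis
    by (simp add: prob_over_def trees_over_def sum.inter_filter[OF finite_spanning_trees[OF finite_V]])
qed

text \<open>The weight of a tree over \<open>F\<close> splits into the weight of \<open>F\<close>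
  and that of the rest; the normalizing constant is the tree sum over the empty forest.\<close>

lemma prob_over_eq:
  "prob_over F = (\<Prod>e\<in>F. weight e) * completions F / completions {}"
proof -
  have Z: "(\<Sum>T\<in>spanning_trees V. tree_weight weight T) = completions {}"
    by (simp add: completions_def trees_over_def tree_weight_def)
  have "pmf tree_law T = (\<Prod>e\<in>F. weight e) * (\<Prod>e\<in>T - F. weight e) / completions {}"
    if "T \<in> trees_over F" for T
  proof -
    have T: "T \<in> spanning_trees V" "F \<subseteq> T" using that by (auto simp: trees_over_def)
    have "pmf tree_law T = tree_weight weight T / completions {}"
      unfolding tree_law_def
      by (subst pmf_random_spanning_tree[OF finite_V V_nonempty weight_pos]) (simp_all add: Z T)
    then show ?thesis
      using prod.subset_diff[OF T(2) finite_tree[OF T(1)], of weight]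
      by (simp add: tree_weight_def mult.commute)
  qed
  then have "prob_over F =
      (\<Sum>T\<in>trees_over F. (\<Prod>e\<in>F. weight e) * (\<Prod>e\<in>T - F. weight e) / completions {})"
    unfolding prob_over_def by (intro sum.cong) simp_all
  then show ?thesis
    by (simp add: completions_def sum_distrib_left sum_divide_distrib)
qed

text \<open>The forest formula for \<open>F\<close> and for the enlarged forest differ by the factor
  from \<open>prod_mass_insert\<close>. This factor is the effective resistance between
  \<open>p\<close> and \<open>q\<close> after contracting \<open>F\<close>; times the edge weight it
  is the conditional probability of the edge.\<close>

lemma prob_over_insert:
  assumes F: "F \<subseteq> complete_edges V" "forest F"
    and pq: "p \<in> V" "q \<in> V" "(p, q) \<notin> reachable F"
  shows "prob_over (insert {p, q} F) = prob_over F * (weight {p, q} * (1 / mass F p + 1 / mass F q))"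
proof -
  have "p \<noteq> q" using pq(3) by auto
  have "{p, q} \<notin> F" using pq(3) reachable_edge by metis
  have finF: "finite F" using F(1) finite_complete_edges[OF finite_V] by (rule finite_subset)
  have "sum c V * completions (insert {p, q} F)
      = (\<Prod>C\<in>forest_components V (insert {p, q} F). sum c C)"
    using F pq \<open>p \<noteq> q\<close> by (intro completions_eq forest_insert) (simp_all add: edge_iff)
  also have "\<dots> = sum c V * completions F * (1 / mass F p + 1 / mass F q)"
    unfolding prod_mass_insert[OF F(1) pq] completions_eq[OF F] ..
  finally have "completions (insert {p, q} F) = completions F * (1 / mass F p + 1 / mass F q)"
    using total_pos by (simp only: mult.assoc mult_cancel_left) simp
  then show ?thesis
    unfolding prob_over_eq using finF \<open>{p, q} \<notin> F\<close> by (simp only: prod.insert) simp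
qed

lemma forest_empty: "forest {}"
  by (simp add: forest_def)

lemma mass_empty: "mass {} p = c p"
proof -
  have "reachable {} `` {p} = {p}" by (auto simp: reachable_def)
  then show ?thesis by (simp add: mass_def)
qed

lemma mass_singleton:
  assumes "p \<noteq> q"
  shows "mass {{p, q}} x = (if x \<in> {p, q} then c p + c q else c x)"
proof -
  have r: "reachable {} `` {y} = {y}" for y :: 'v by (auto simp: reachable_def)
  show ?thesis
    using component_insert[of x "{}" p q] component_insert_other[of x "{}" p q] assms
    by (auto simp: mass_def r)
qed

definition edge_prob :: "'v \<times> 'v \<Rightarrow> real" where
  "edge_prob e = (c (fst e) + c (snd e)) / sum c V"

lemma prob_over_edge:
  assumes "p \<in> V" "q \<in> V" "p \<noteq> q"
  shows "prob_over {{p, q}} = edge_prob (p, q)"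
proof -
  have "prob_over {{p, q}} = weight {p, q} * (1 / c p + 1 / c q)"
    using prob_over_insert[of "{}" p q] assms forest_empty
    by (auto simp: mass_empty prob_over_empty reachable_def)
  also have "\<dots> = edge_prob (p, q)"
    using c_pos[OF assms(1)] c_pos[OF assms(2)] total_pos assms(3)
    by (simp add: weight_edge edge_prob_def field_simps)
  finally show ?thesis .
qed

text \<open>Two distinct edges always form a forest, so the insertion formula applies with the first
  edge as the given forest.\<close>

lemma prob_over_two_edges:
  assumes pq: "p \<in> V" "q \<in> V" "p \<noteq> q" and rs: "r \<in> V" "s \<in> V" "r \<noteq> s"
    and ne: "{r, s} \<noteq> {p, q}"
  shows "prob_over {{p, q}, {r, s}} =
    edge_prob (p, q) * (weight {r, s} * (1 / mass {{p, q}} r + 1 / mass {{p, q}} s))"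
proof -
  have f: "forest {{p, q}}"
    using forest_insert[of "{}" p q] forest_empty pq by (auto simp: reachable_def)
  have "(r, s) \<notin> reachable (insert {p, q} {})"
    using rs(3) ne unfolding reachable_insert by (auto simp: reachable_def)
  then have "prob_over (insert {r, s} {{p, q}}) =
      prob_over {{p, q}} * (weight {r, s} * (1 / mass {{p, q}} r + 1 / mass {{p, q}} s))"
    using pq f rs by (intro prob_over_insert) (auto simp: edge_iff)
  then show ?thesis using pq by (simp add: prob_over_edge insert_commute)
qed

definition incident :: "'v \<Rightarrow> 'v \<times> 'v \<Rightarrow> real" where
  "incident v e = of_bool (v = fst e \<or> v = snd e)"

lemma sum_incident:
  assumes "p \<in> V" "q \<in> V" "p \<noteq> q"
  shows "(\<Sum>v\<in>V. incident v (p, q) * incident v f / (c v)\<^sup>2)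
    = incident p f / (c p)\<^sup>2 + incident q f / (c q)\<^sup>2"
proof -
  have "(\<Sum>v\<in>V. incident v (p, q) * incident v f / (c v)\<^sup>2)
      = (\<Sum>v\<in>{p, q}. incident v (p, q) * incident v f / (c v)\<^sup>2)"
    using assms finite_V by (intro sum.mono_neutral_right) (auto simp: incident_def)
  then show ?thesis using assms(3) by (simp add: incident_def)
qed

text \<open>The squared entry of the transfer current matrix of the edges \<open>e\<close> and \<open>f\<close> is
  \<open>w\<^sub>e w\<^sub>f (b\<^sub>e\<^sup>T C\<^sup>-\<^sup>1 b\<^sub>f)\<^sup>2\<close>, where \<open>C\<close> is the diagonal matrix of the conductances; it vanishes unless
  the edges share an endpoint.\<close>

lemma edge_covariance:
  assumes e: "p \<in> V" "q \<in> V" "p \<noteq> q" and f: "r \<in> V" "s \<in> V" "r \<noteq> s"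
    and orient: "(r, s) \<noteq> (q, p)"
  shows "prob_over {{p, q}, {r, s}} - edge_prob (p, q) * edge_prob (r, s) =
    (if (p, q) = (r, s) then edge_prob (p, q) - 2 * (weight {p, q})\<^sup>2 / (c p * c q) else 0)
     - weight {p, q} * weight {r, s} * (\<Sum>v\<in>V. incident v (p, q) * incident v (r, s) / (c v)\<^sup>2)"
proof -
  note pos = c_pos[OF e(1)] c_pos[OF e(2)] c_pos[OF f(1)] c_pos[OF f(2)] total_pos
  show ?thesis
  proof (cases "(p, q) = (r, s)")
    \<comment> \<open>With \<open>P = w * (1 / c p + 1 / c q)\<close> the variance is
      \<open>P - P\<^sup>2\<close>. The mixed term of the square is the one split off explicitly;
      the two pure squares form the incidence sum.\<close>
    case True
    then show ?thesis
      using pos e unfolding sum_incident[OF e]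
      by (simp add: prob_over_edge edge_prob_def weight_edge incident_def field_simps power2_eq_square)
  next
    case False
    then have "{r, s} \<noteq> {p, q}" using orient by (auto simp: doubleton_eq_iff)
    then have two: "prob_over {{p, q}, {r, s}} =
      edge_prob (p, q) * (weight {r, s} * (1 / mass {{p, q}} r + 1 / mass {{p, q}} s))"
      by (rule prob_over_two_edges[OF e f])
    have nz: "c p + c q \<noteq> 0" "c p \<noteq> 0" "c q \<noteq> 0" "c r \<noteq> 0" "c s \<noteq> 0" "sum c V \<noteq> 0"
      using pos by simp_all
    define Q where "Q = prob_over {{p, q}, {r, s}} - edge_prob (p, q) * edge_prob (r, s)"
    define S where "S = (\<Sum>v\<in>V. incident v (p, q) * incident v (r, s) / (c v)\<^sup>2)"
    have S: "S = incident p (r, s) / (c p)\<^sup>2 + incident q (r, s) / (c q)\<^sup>2"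
      unfolding S_def by (rule sum_incident[OF e])
    have w: "weight {p, q} = c p * c q / sum c V" "weight {r, s} = c r * c s / sum c V"
      using e f by (simp_all add: weight_edge)
    \<comment> \<open>Here \<open>x\<close> is the conductance of the shared vertex and
      \<open>y\<close>, \<open>z\<close> are those of the free ends: the difference of
      \<open>x * (x + y + z)\<close> and \<open>(x + y) * (x + z)\<close> is
      \<open>- y * z\<close>.\<close>
    have shared: "Q = - (y * z) / (sum c V)\<^sup>2"
      if "edge_prob (p, q) = (x + y) / sum c V" "weight {r, s} = x * z / sum c V"
        "1 / mass {{p, q}} r + 1 / mass {{p, q}} s = 1 / (x + y) + 1 / z"
        "edge_prob (r, s) = (x + z) / sum c V" "x + y \<noteq> 0" "z \<noteq> 0" for x y z
    proof -
      have "(x + y) * (x * z * (1 / (x + y) + 1 / z)) = x * (x + y + z)"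
        using that(5,6) by (simp add: divide_simps)
      then have eq: "(x + y) / t * (x * z / t * (1 / (x + y) + 1 / z)) = x * (x + y + z) / t\<^sup>2" for t
        by (simp add: power2_eq_square)
      show ?thesis
        unfolding Q_def two that(1-4) eq
        by (simp add: power2_eq_square diff_divide_distrib[symmetric] algebra_simps)
    qed
    \<comment> \<open>Equal and opposite orientations are excluded, so the edges share exactly one
      vertex, in four possible positions, or none.\<close>
    consider "r = p" "s \<noteq> q" "s \<noteq> p" | "r = q" "s \<noteq> p" "s \<noteq> q" | "s = p" "r \<noteq> p" "r \<noteq> q"
      | "s = q" "r \<noteq> p" "r \<noteq> q" | "r \<noteq> p" "r \<noteq> q" "s \<noteq> p" "s \<noteq> q"
      using False orient f(3) by blast
    then have "Q = - weight {p, q} * weight {r, s} * S"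
    proof cases
      case 1
      have "Q = - (c q * c s) / (sum c V)\<^sup>2"
        using 1 nz e(3) w by (intro shared[of "c p"]) (simp_all add: mass_singleton edge_prob_def)
      also have "\<dots> = - weight {p, q} * weight {r, s} * S"
        using 1 nz e(3) f(3) w unfolding S by (simp add: incident_def power2_eq_square)
      finally show ?thesis .
    next
      case 2
      have "Q = - (c p * c s) / (sum c V)\<^sup>2"
        using 2 nz e(3) w by (intro shared[of "c q"])
          (simp_all add: mass_singleton edge_prob_def add.commute)
      also have "\<dots> = - weight {p, q} * weight {r, s} * S"
        using 2 nz e(3) f(3) w unfolding S by (simp add: incident_def power2_eq_square)
      finally show ?thesis .
    next
      case 3
      have "Q = - (c q * c r) / (sum c V)\<^sup>2"
        using 3 nz e(3) w by (intro shared[of "c p"])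
          (simp_all add: mass_singleton edge_prob_def add.commute)
      also have "\<dots> = - weight {p, q} * weight {r, s} * S"
        using 3 nz e(3) f(3) w unfolding S by (simp add: incident_def power2_eq_square)
      finally show ?thesis .
    next
      case 4
      have "Q = - (c p * c r) / (sum c V)\<^sup>2"
        using 4 nz e(3) w by (intro shared[of "c q"])
          (simp_all add: mass_singleton edge_prob_def add.commute)
      also have "\<dots> = - weight {p, q} * weight {r, s} * S"
        using 4 nz e(3) f(3) w unfolding S by (simp add: incident_def power2_eq_square)
      finally show ?thesis .
    next
      case 5
      \<comment> \<open>Contracting a disjoint edge leaves both masses unchanged, so the conditional
        probability is the marginal one.\<close>
      have "weight {r, s} * (1 / mass {{p, q}} r + 1 / mass {{p, q}} s) = edge_prob (r, s)"
        using 5 nz e(3) by (simp add: mass_singleton edge_prob_def w divide_simps)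
      moreover have "S = 0" using 5 e(3) by (simp add: S incident_def)
      ultimately show ?thesis by (simp add: Q_def two)
    qed
    then show ?thesis unfolding Q_def S_def if_not_P[OF False] by simp
  qed
qed

text \<open>The matrix of squared transfer current entries is positive semidefinite (a Schur product);
  the proof exhibits its quadratic form as a sum of squares indexed by the vertices.\<close>

lemma second_moment_le:
  fixes u :: "'v \<times> 'v \<Rightarrow> 'b::real_inner"
  assumes D: "D \<subseteq> V \<times> V" and orient: "\<And>p q. (p, q) \<in> D \<Longrightarrow> p \<noteq> q \<and> (q, p) \<notin> D"
  shows "(\<Sum>T\<in>spanning_trees V. pmf tree_law T *
      (norm (\<Sum>e\<in>D. (of_bool ({fst e, snd e} \<in> T) - edge_prob e) *\<^sub>R u e))\<^sup>2)
    \<le> (\<Sum>e\<in>D. edge_prob e * (norm (u e))\<^sup>2)"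
proof -
  define w where "w e = weight {fst e, snd e}" for e :: "'v \<times> 'v"
  define X where "X T e = of_bool ({fst e, snd e} \<in> T) - edge_prob e" for T and e :: "'v \<times> 'v"
  define S where "S = spanning_trees V"
  define P where "P = pmf tree_law"
  have finD: "finite D" using D finite_V by (meson finite_SigmaI finite_subset)
  have sum_P: "sum P S = 1" unfolding P_def S_def by (rule sum_pmf_tree_law)
  have edge: "fst e \<in> V" "snd e \<in> V" "fst e \<noteq> snd e" if "e \<in> D" for e
    using that D orient[of "fst e" "snd e"] by auto
  have marginal: "(\<Sum>T\<in>S. P T * of_bool ({fst e, snd e} \<in> T)) = edge_prob e" if "e \<in> D" for e
    using prob_over_edge[OF edge[OF that]] prob_over_eq_sum[of "{{fst e, snd e}}"]
    by (simp add: P_def S_def)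
  have cov: "(\<Sum>T\<in>S. P T * (X T e * X T f)) =
      (if e = f then edge_prob e - 2 * (w e)\<^sup>2 / (c (fst e) * c (snd e)) else 0)
      - w e * w f * (\<Sum>v\<in>V. incident v e * incident v f / (c v)\<^sup>2)"
    if ef: "e \<in> D" "f \<in> D" for e f
  proof -
    \<comment> \<open>The product of the two indicators is the indicator of containing both edges;
      for \<open>e = f\<close> the set of edges collapses to a singleton.\<close>
    have "(\<Sum>T\<in>S. P T * (X T e * X T f)) =
        (\<Sum>T\<in>S. P T * of_bool ({{fst e, snd e}, {fst f, snd f}} \<subseteq> T)
          - edge_prob f * (P T * of_bool ({fst e, snd e} \<in> T))
          - edge_prob e * (P T * of_bool ({fst f, snd f} \<in> T)) + edge_prob e * edge_prob f * P T)"
      by (intro sum.cong) (auto simp: X_def algebra_simps)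
    also have "\<dots> = prob_over {{fst e, snd e}, {fst f, snd f}} - edge_prob e * edge_prob f"
      by (simp add: sum.distrib sum_subtractf sum_distrib_left[symmetric] marginal ef sum_P
          prob_over_eq_sum S_def[symmetric] P_def[symmetric])
    also have "\<dots> = (if e = f then edge_prob e - 2 * (w e)\<^sup>2 / (c (fst e) * c (snd e)) else 0)
      - w e * w f * (\<Sum>v\<in>V. incident v e * incident v f / (c v)\<^sup>2)"
    proof -
      have "(fst f, snd f) \<noteq> (snd e, fst e)"
        using ef orient[of "fst e" "snd e"] by (metis prod.collapse)
      from edge_covariance[OF edge[OF ef(1)] edge[OF ef(2)] this] show ?thesis
        by (cases e; cases f) (simp add: w_def)
    qed
    finally show ?thesis .
  qed
  have "(\<Sum>T\<in>S. P T * (norm (\<Sum>e\<in>D. X T e *\<^sub>R u e))\<^sup>2) =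
      (\<Sum>T\<in>S. \<Sum>e\<in>D. \<Sum>f\<in>D. P T * (X T e * X T f) * (u e \<bullet> u f))"
    by (simp add: power2_norm_sum_scaleR sum_distrib_left mult.assoc)
  also have "\<dots> = (\<Sum>e\<in>D. \<Sum>f\<in>D. (\<Sum>T\<in>S. P T * (X T e * X T f)) * (u e \<bullet> u f))"
    unfolding sum_distrib_right
    by (subst sum.swap) (intro sum.cong refl sum.swap)
  also have "\<dots> = (\<Sum>e\<in>D. \<Sum>f\<in>D.
      ((if e = f then edge_prob e - 2 * (w e)\<^sup>2 / (c (fst e) * c (snd e)) else 0) * (u e \<bullet> u f)
      - (\<Sum>v\<in>V. (incident v e * w e) * (incident v f * w f) * (u e \<bullet> u f) / (c v)\<^sup>2)))"
  proof (intro sum.cong refl)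
    fix e f assume ef: "e \<in> D" "f \<in> D"
    have "w e * w f * (\<Sum>v\<in>V. incident v e * incident v f / (c v)\<^sup>2) * (u e \<bullet> u f)
        = (\<Sum>v\<in>V. (incident v e * w e) * (incident v f * w f) * (u e \<bullet> u f) / (c v)\<^sup>2)"
      unfolding sum_distrib_left sum_distrib_right by (intro sum.cong refl) (simp add: mult_ac)
    then show "(\<Sum>T\<in>S. P T * (X T e * X T f)) * (u e \<bullet> u f) =
      (if e = f then edge_prob e - 2 * (w e)\<^sup>2 / (c (fst e) * c (snd e)) else 0) * (u e \<bullet> u f)
      - (\<Sum>v\<in>V. (incident v e * w e) * (incident v f * w f) * (u e \<bullet> u f) / (c v)\<^sup>2)"
      unfolding cov[OF ef] left_diff_distrib by (simp only:)
  qed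
  also have "\<dots> = (\<Sum>e\<in>D. (edge_prob e - 2 * (w e)\<^sup>2 / (c (fst e) * c (snd e))) * (u e \<bullet> u e))
      - (\<Sum>e\<in>D. \<Sum>f\<in>D. \<Sum>v\<in>V. (incident v e * w e) * (incident v f * w f) * (u e \<bullet> u f) / (c v)\<^sup>2)"
    by (simp add: sum_subtractf if_distrib[of "\<lambda>x. x * _"] sum.delta finD cong: if_cong)
  \<comment> \<open>For fixed \<open>v\<close> the coefficient is a product of a factor in
    \<open>e\<close> and a factor in \<open>f\<close>, so the double sum is a squared norm.\<close>
  also have "(\<Sum>e\<in>D. \<Sum>f\<in>D. \<Sum>v\<in>V. (incident v e * w e) * (incident v f * w f) * (u e \<bullet> u f) / (c v)\<^sup>2)
      = (\<Sum>v\<in>V. (norm (\<Sum>e\<in>D. (incident v e * w e) *\<^sub>R u e))\<^sup>2 / (c v)\<^sup>2)"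
  proof -
    have "(norm (\<Sum>e\<in>D. (incident v e * w e) *\<^sub>R u e))\<^sup>2 / (c v)\<^sup>2 =
      (\<Sum>e\<in>D. \<Sum>f\<in>D. (incident v e * w e) * (incident v f * w f) * (u e \<bullet> u f) / (c v)\<^sup>2)" for v
      by (simp add: power2_norm_sum_scaleR sum_divide_distrib)
    then show ?thesis
      by (simp add: sum.swap[of _ V])
  qed
  \<comment> \<open>Both subtracted contributions, the diagonal correction and the sum of squares,
    are nonnegative and are dropped.\<close>
  also have "(\<Sum>e\<in>D. (edge_prob e - 2 * (w e)\<^sup>2 / (c (fst e) * c (snd e))) * (u e \<bullet> u e))
      - (\<Sum>v\<in>V. (norm (\<Sum>e\<in>D. (incident v e * w e) *\<^sub>R u e))\<^sup>2 / (c v)\<^sup>2)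
      \<le> (\<Sum>e\<in>D. edge_prob e * (norm (u e))\<^sup>2) - 0"
  proof (intro diff_mono sum_mono sum_nonneg)
    fix e assume "e \<in> D"
    then have "0 \<le> 2 * (w e)\<^sup>2 / (c (fst e) * c (snd e)) * (u e \<bullet> u e)"
      using c_pos edge by (intro mult_nonneg_nonneg divide_nonneg_nonneg) (auto simp: less_imp_le)
    then show "(edge_prob e - 2 * (w e)\<^sup>2 / (c (fst e) * c (snd e))) * (u e \<bullet> u e)
        \<le> edge_prob e * (norm (u e))\<^sup>2"
      by (simp add: power2_norm_eq_inner left_diff_distrib)
  qed simp
  finally show ?thesis by (simp add: X_def P_def S_def)
qed

end

section \<open>Square roots and pseudoinverses of symmetric matrices\<close>

lemma symmetric_inner:
  fixes A :: "real ^ 'n ^ 'n"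
  assumes "transpose A = A"
  shows "x \<bullet> (A *v y) = (A *v x) \<bullet> y"
  by (metis assms dot_lmul_matrix transpose_matrix_vector)

section \<open>Spectral theorem for real symmetric matrices\<close>

lemma nonneg_quadratic_imp_linear_zero:
  fixes b c :: real
  assumes "\<And>t. 0 \<le> 2 * t * b + t\<^sup>2 * c"
  shows "b = 0"
proof (rule ccontr)
  assume "b \<noteq> 0"
  define s where "s = \<bar>c\<bar> + 1"
  have "s > 0" by (simp add: s_def)
  \<comment> \<open>The value \<open>t = - b / s\<close> makes the linear term dominate: since
    \<open>s\<close> exceeds the absolute value of \<open>c\<close>, the factor
    \<open>c - 2 * s\<close> is negative.\<close>
  have "0 \<le> s\<^sup>2 * (2 * (- b / s) * b + (- b / s)\<^sup>2 * c)"
    by (intro mult_nonneg_nonneg zero_le_power2 assms)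
  also have "\<dots> = b\<^sup>2 * (c - 2 * s)"
    using \<open>s > 0\<close> by (simp add: power2_eq_square field_simps)
  finally show False
    using \<open>b \<noteq> 0\<close> by (simp add: zero_le_mult_iff s_def)
qed

text \<open>The vector \<open>v\<close> maximizes the quadratic form on the unit sphere of
  \<open>W\<close>. The first-order condition makes \<open>l *\<^sub>R v - A *v v\<close> orthogonal
  to \<open>W\<close>; it lies in \<open>W\<close> by invariance, so it vanishes.\<close>

lemma symmetric_eigenvector:
  fixes A :: "real ^ 'n ^ 'n"
  assumes A: "transpose A = A" and W: "subspace W" "W \<noteq> {0}" and inv: "\<And>x. x \<in> W \<Longrightarrow> A *v x \<in> W"
  obtains v l where "v \<in> W" "norm v = 1" "A *v v = l *\<^sub>R v"
proof -
  let ?K = "W \<inter> sphere 0 1"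
  have "compact ?K" using closed_subspace[OF W(1)] by (rule closed_Int_compact) simp
  moreover have "?K \<noteq> {}"
  proof -
    obtain w where "w \<in> W" "w \<noteq> 0" using W subspace_0 by blast
    then have "(1 / norm w) *\<^sub>R w \<in> ?K" using W(1) by (simp add: subspace_scale)
    then show ?thesis by blast
  qed
  moreover have "continuous_on ?K (\<lambda>x. x \<bullet> (A *v x))"
    by (intro continuous_intros)
  ultimately obtain v where v: "v \<in> ?K" and max: "\<And>x. x \<in> ?K \<Longrightarrow> x \<bullet> (A *v x) \<le> v \<bullet> (A *v v)"
    using continuous_attains_sup[of ?K "\<lambda>x. x \<bullet> (A *v x)"] by blast
  define l where "l = v \<bullet> (A *v v)"
  have vv: "v \<bullet> v = 1" "norm v = 1" "v \<in> W" using v by (auto simp: dot_square_norm)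
  have le: "x \<bullet> (A *v x) \<le> l * (x \<bullet> x)" if "x \<in> W" for x
  proof (cases "x = 0")
    case False
    have "(1 / norm x) *\<^sub>R x \<in> ?K" using False that W(1) by (simp add: subspace_scale)
    from max[OF this] have "(x \<bullet> (A *v x)) / (norm x)\<^sup>2 \<le> l"
      by (simp add: l_def matrix_vector_mult_scaleR power2_eq_square)
    then show ?thesis using False by (simp add: divide_le_eq power2_norm_eq_inner)
  qed (simp add: matrix_vector_mult_0_right)
  have orth: "w \<bullet> (l *\<^sub>R v - A *v v) = 0" if w: "w \<in> W" for w
  proof (rule nonneg_quadratic_imp_linear_zero)
    fix t :: real
    have "v + t *\<^sub>R w \<in> W" using vv(3) w W(1) by (simp add: subspace_add subspace_scale)
    from le[OF this]
    show "0 \<le> 2 * t * (w \<bullet> (l *\<^sub>R v - A *v v)) + t\<^sup>2 * (l * (w \<bullet> w) - w \<bullet> (A *v w))"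
      using symmetric_inner[OF A, of v w] vv(1)
      by (simp add: matrix_vector_mult_scaleR matrix_vector_right_distrib inner_add_left
          inner_add_right inner_diff_right algebra_simps power2_eq_square l_def[symmetric] inner_commute)
  qed
  have "l *\<^sub>R v - A *v v \<in> W" using vv(3) W(1) inv by (simp add: subspace_diff subspace_scale)
  from orth[OF this] have "A *v v = l *\<^sub>R v" by simp
  then show ?thesis using that vv by blast
qed

text \<open>By symmetry the part of \<open>W\<close> orthogonal to an eigenvector is again
  invariant, and its dimension is smaller.\<close>

lemma symmetric_orthonormal_eigenbasis_subspace:
  fixes A :: "real ^ 'n ^ 'n"
  assumes A: "transpose A = A" and W: "subspace W" and inv: "\<And>x. x \<in> W \<Longrightarrow> A *v x \<in> W"
  shows "\<exists>B. finite B \<and> B \<subseteq> W \<and> W \<subseteq> span B \<and> pairwise orthogonal B \<and>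
    (\<forall>v\<in>B. norm v = 1 \<and> (\<exists>l. A *v v = l *\<^sub>R v))"
  using W inv
proof (induction "dim W" arbitrary: W rule: less_induct)
  case less
  show ?case
  proof (cases "W = {0}")
    case True
    then show ?thesis by (intro exI[of _ "{}"]) auto
  next
    case False
    obtain v l where v: "v \<in> W" "norm v = 1" "A *v v = l *\<^sub>R v"
      using symmetric_eigenvector[OF A less.prems(1) False less.prems(2)] by blast
    have vv: "v \<bullet> v = 1" using v(2) by (simp add: dot_square_norm)
    define W' where "W' = {x \<in> W. v \<bullet> x = 0}"
    have sub: "subspace W'"
      using less.prems(1) unfolding W'_def subspace_def by (auto simp: inner_add_right)
    have inv': "A *v x \<in> W'" if "x \<in> W'" for x
      using that less.prems(2) symmetric_inner[OF A, of v x] v(3) by (simp add: W'_def)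
    have "W' \<subseteq> W" "v \<notin> W'" using vv by (auto simp: W'_def)
    then have "W' \<subset> W" using v(1) by blast
    then have "dim W' < dim W"
      using sub less.prems(1) by (intro dim_psubset) (simp add: span_eq_iff[THEN iffD2])
    from less.hyps[OF this sub inv'] obtain B where B: "finite B" "B \<subseteq> W'" "W' \<subseteq> span B"
      "pairwise orthogonal B" "\<forall>v\<in>B. norm v = 1 \<and> (\<exists>l. A *v v = l *\<^sub>R v)" by blast
    have "W \<subseteq> span (insert v B)"
    proof
      fix x assume "x \<in> W"
      then have "x - (v \<bullet> x) *\<^sub>R v \<in> W'"
        using less.prems(1) v(1) vv by (simp add: W'_def subspace_diff subspace_scale inner_diff_right)
      then have "x - (v \<bullet> x) *\<^sub>R v \<in> span (insert v B)"
        using B(3) span_mono[of B "insert v B"] by blast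
      moreover have "(v \<bullet> x) *\<^sub>R v \<in> span (insert v B)" by (simp add: span_base span_scale)
      ultimately have "x - (v \<bullet> x) *\<^sub>R v + (v \<bullet> x) *\<^sub>R v \<in> span (insert v B)" by (rule span_add)
      then show "x \<in> span (insert v B)" by simp
    qed
    moreover have "pairwise orthogonal (insert v B)"
      using B(2,4) by (auto simp: pairwise_insert orthogonal_def W'_def inner_commute)
    moreover have "insert v B \<subseteq> W" using v(1) B(2) by (auto simp: W'_def)
    ultimately show ?thesis
      using B(1,5) v by (intro exI[of _ "insert v B"]) auto
  qed
qed

lemma symmetric_orthonormal_eigenbasis:
  fixes A :: "real ^ 'n ^ 'n"
  assumes "transpose A = A"
  obtains B l where "finite B" "span B = UNIV" "pairwise orthogonal B"
    "\<And>v. v \<in> B \<Longrightarrow> v \<bullet> v = 1" "\<And>v. v \<in> B \<Longrightarrow> A *v v = l v *\<^sub>R v"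
proof -
  obtain B where B: "finite B" "UNIV \<subseteq> span B" "pairwise orthogonal B"
    "\<forall>v\<in>B. norm v = 1 \<and> (\<exists>l. A *v v = l *\<^sub>R v)"
    using symmetric_orthonormal_eigenbasis_subspace[OF assms subspace_UNIV] by blast
  from B(4) obtain l where "\<forall>v\<in>B. A *v v = l v *\<^sub>R v" by metis
  then show ?thesis using B by (intro that[of B l]) (auto simp: dot_square_norm)
qed

lemma matrix_eqI_spanning:
  fixes A C :: "real ^ 'n ^ 'm"
  assumes "span B = UNIV" "\<And>v. v \<in> B \<Longrightarrow> A *v v = C *v v"
  shows "A = C"
proof -
  have "A *v x = C *v x" for x
    by (rule linear_eq_on_span[of "(*v) A" "(*v) C" B]) (use assms in auto)
  then show ?thesis by (simp add: matrix_eq)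
qed

section \<open>Square roots of positive semidefinite matrices\<close>

lemma psd_sqrt_exists:
  fixes A :: "real ^ 'n ^ 'n"
  assumes "psd A"
  shows "\<exists>S. psd S \<and> S ** S = A"
proof -
  have "transpose A = A" using assms by (simp add: psd_def)
  from symmetric_orthonormal_eigenbasis[OF this] obtain B l where B: "finite B" "span B = UNIV" "pairwise orthogonal B"
    "\<And>v. v \<in> B \<Longrightarrow> v \<bullet> v = 1" "\<And>v. v \<in> B \<Longrightarrow> A *v v = l v *\<^sub>R v"
    by blast
  have l: "0 \<le> l v" if "v \<in> B" for v
    using assms B(4,5)[OF that] unfolding psd_def by (metis inner_scaleR_right mult.right_neutral)
  \<comment> \<open>The spectral decomposition of \<open>A\<close> with each eigenvalue replaced by
    its root.\<close>
  define S :: "real ^ 'n ^ 'n" where "S = (\<chi> i j. \<Sum>v\<in>B. sqrt (l v) * (v $ i * v $ j))"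
  have S: "S *v x = (\<Sum>v\<in>B. (sqrt (l v) * (v \<bullet> x)) *\<^sub>R v)" for x
  proof -
    have "(\<Sum>j\<in>UNIV. (\<Sum>v\<in>B. sqrt (l v) * (v $ i * v $ j)) * x $ j)
        = (\<Sum>v\<in>B. sqrt (l v) * (v \<bullet> x) * v $ i)" for i
      unfolding sum_distrib_right
      by (subst sum.swap) (simp add: inner_vec_def sum_distrib_left sum_distrib_right mult_ac)
    then show ?thesis by (simp add: vec_eq_iff matrix_vector_mult_def S_def)
  qed
  have Sv: "S *v v = sqrt (l v) *\<^sub>R v" if "v \<in> B" for v
  proof -
    have "S *v v = (\<Sum>u\<in>B. if u = v then sqrt (l v) *\<^sub>R v else 0)"
      unfolding S using that B(3,4) by (intro sum.cong) (auto simp: pairwise_def orthogonal_def)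
    then show ?thesis using that B(1) by simp
  qed
  have "S ** S = A"
    using B(2)
  proof (rule matrix_eqI_spanning)
    fix v assume v: "v \<in> B"
    show "S ** S *v v = A *v v"
      using Sv[OF v] B(5)[OF v] l[OF v]
      by (simp add: matrix_vector_mul_assoc[symmetric] matrix_vector_mult_scaleR)
  qed
  moreover have "psd S"
    unfolding psd_def
  proof (intro conjI allI)
    show "transpose S = S" by (simp add: S_def transpose_def vec_eq_iff mult.commute)
    fix x
    have "x \<bullet> (S *v x) = (\<Sum>v\<in>B. sqrt (l v) * (v \<bullet> x)\<^sup>2)"
      by (simp add: S inner_sum_right power2_eq_square inner_commute mult_ac)
    then show "0 \<le> x \<bullet> (S *v x)" using l by (simp add: sum_nonneg)
  qed
  ultimately show ?thesis by blast
qed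

text \<open>Let \<open>v\<close> be an eigenvector of \<open>S\<close> with eigenvalue
  \<open>l v\<close>. The defect \<open>w = R *v v - l v *\<^sub>R v\<close> satisfies
  \<open>R *v w = - l v *\<^sub>R w\<close>, which positivity of \<open>R\<close> permits only for
  \<open>w = 0\<close> or \<open>l v = 0\<close>. In the latter case
  \<open>R *v (R *v v) = 0\<close> forces \<open>R *v v = 0\<close>.\<close>

lemma psd_sqrt_unique:
  fixes R S :: "real ^ 'n ^ 'n"
  assumes R: "psd R" and S: "psd S" and eq: "R ** R = S ** S"
  shows "R = S"
proof -
  have "transpose S = S" using S by (simp add: psd_def)
  from symmetric_orthonormal_eigenbasis[OF this] obtain B l where "finite B" and B: "span B = UNIV" and "pairwise orthogonal B"
    and Bv: "\<And>v. v \<in> B \<Longrightarrow> v \<bullet> v = 1" "\<And>v. v \<in> B \<Longrightarrow> S *v v = l v *\<^sub>R v"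
    by blast
  have "R *v v = S *v v" if v: "v \<in> B" for v
  proof -
    have l: "0 \<le> l v"
      using S Bv[OF v] unfolding psd_def by (metis inner_scaleR_right mult.right_neutral)
    have RR: "R *v (R *v v) = (l v)\<^sup>2 *\<^sub>R v"
    proof -
      have "R *v (R *v v) = S *v (S *v v)" by (simp only: matrix_vector_mul_assoc eq)
      then show ?thesis by (simp add: Bv(2)[OF v] matrix_vector_mult_scaleR power2_eq_square)
    qed
    define w where "w = R *v v - l v *\<^sub>R v"
    have "R *v w = - l v *\<^sub>R w"
      by (simp add: w_def matrix_vector_mult_diff_distrib matrix_vector_mult_scaleR RR
          algebra_simps power2_eq_square)
    then have "0 \<le> - (l v * (w \<bullet> w))" using R unfolding psd_def by (metis inner_scaleR_right mult_minus_left)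
    moreover have "0 \<le> l v * (w \<bullet> w)" using l by simp
    ultimately have "l v * (w \<bullet> w) = 0" by linarith
    moreover have "w = 0" if "l v = 0"
    proof -
      have "(R *v v) \<bullet> (R *v v) = v \<bullet> (R *v (R *v v))"
        using R symmetric_inner[of R v "R *v v"] by (simp add: psd_def)
      then show ?thesis using RR that by (simp add: w_def)
    qed
    ultimately have "w = 0" by auto
    then show ?thesis using Bv(2)[OF v] by (simp add: w_def)
  qed
  with B show ?thesis by (rule matrix_eqI_spanning)
qed

lemma psd_sqrt:
  assumes "psd A"
  shows psd_psd_sqrt: "psd (psd_sqrt A)" and psd_sqrt_square: "psd_sqrt A ** psd_sqrt A = A"
proof -
  have "\<exists>!S. psd S \<and> S ** S = A"
    using psd_sqrt_exists[OF assms] psd_sqrt_unique by blast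
  from theI'[OF this] show "psd (psd_sqrt A)" "psd_sqrt A ** psd_sqrt A = A"
    by (simp_all add: psd_sqrt_def)
qed

text \<open>The symmetry conditions give \<open>A ** X = A ** Y\<close> and
  \<open>X ** A = Y ** A\<close>; then \<open>X = X ** A ** X\<close> turns into
  \<open>Y ** A ** Y = Y\<close>.\<close>

lemma pseudoinverse_unique:
  assumes X: "is_pseudoinverse A X" and Y: "is_pseudoinverse A Y"
  shows "X = Y"
proof -
  note defs = X[unfolded is_pseudoinverse_def] Y[unfolded is_pseudoinverse_def]
  have "A ** X = transpose (A ** X)" using defs by simp
  also have "\<dots> = transpose ((A ** Y) ** (A ** X))"
    using defs by (simp add: matrix_mul_assoc)
  also have "\<dots> = transpose (A ** X) ** transpose (A ** Y)" by (rule matrix_transpose_mul)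
  also have "\<dots> = (A ** X ** A) ** Y" using defs by (simp add: matrix_mul_assoc)
  finally have AX: "A ** X = A ** Y" using defs by simp
  have "X ** A = X ** (A ** Y ** A)" using defs by simp
  then have "X ** A = (X ** A) ** (Y ** A)" by (simp only: matrix_mul_assoc)
  then have "transpose (X ** A) = transpose (Y ** A) ** transpose (X ** A)"
    by (metis matrix_transpose_mul)
  then have "X ** A = (Y ** A) ** (X ** A)" using defs by simp
  also have "\<dots> = Y ** (A ** X ** A)" by (simp only: matrix_mul_assoc)
  finally have XA: "X ** A = Y ** A" using defs by simp
  have "X = X ** A ** X" using defs by simp
  also have "\<dots> = Y ** (A ** X)" by (simp add: XA matrix_mul_assoc)
  also have "\<dots> = Y" using defs by (simp add: AX matrix_mul_assoc)
  finally show ?thesis .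
qed

lemma pseudoinverse_eqI: "is_pseudoinverse A X \<Longrightarrow> pseudoinverse A = X"
  unfolding pseudoinverse_def by (rule the_equality) (auto intro: pseudoinverse_unique)

section \<open>The pseudoinverse of the Schur clique\<close>

lemma symmetric_scaleR: "transpose A = A \<Longrightarrow> transpose (c *\<^sub>R A) = c *\<^sub>R A"
  for A :: "real ^ 'n ^ 'n"
  by (simp add: vec_eq_iff transpose_def)

lemma symmetric_sum:
  fixes A :: "'a \<Rightarrow> real ^ 'n ^ 'n"
  assumes "\<And>i. i \<in> I \<Longrightarrow> transpose (A i) = A i"
  shows "transpose (\<Sum>i\<in>I. A i) = (\<Sum>i\<in>I. A i)"
proof -
  have "(\<Sum>i\<in>I. A i $ k $ j) = (\<Sum>i\<in>I. A i $ j $ k)" for j k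
    using assms by (intro sum.cong) (auto simp: vec_eq_iff transpose_def)
  then show ?thesis by (simp add: vec_eq_iff transpose_def)
qed

lemma symmetric_congruence:
  fixes A S :: "real ^ 'n ^ 'n"
  assumes "transpose A = A" "transpose S = S"
  shows "transpose (S ** A ** S) = S ** A ** S"
  using assms by (simp add: matrix_transpose_mul matrix_mul_assoc)

lemma matrix_mul_sum_scaleR:
  fixes A B :: "real ^ 'n ^ 'n"
  shows "A ** (\<Sum>i\<in>I. x i *\<^sub>R X i) ** B = (\<Sum>i\<in>I. x i *\<^sub>R (A ** X i ** B))"
proof -
  have lin: "linear (\<lambda>X. A ** X ** B)"
    by (rule linearI)
      (simp_all add: vec_eq_iff matrix_matrix_mult_def sum_distrib_left sum_distrib_right
        sum.distrib algebra_simps)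
  show ?thesis by (simp add: linear_sum[OF lin] linear_scale[OF lin])
qed

lemma sum_scaleR_matrix_vector_mult:
  fixes X :: "'a \<Rightarrow> real ^ 'n ^ 'm"
  shows "(\<Sum>i\<in>I. x i *\<^sub>R X i) *v y = (\<Sum>i\<in>I. x i *\<^sub>R (X i *v y))"
proof -
  have lin: "linear (\<lambda>A :: real ^ 'n ^ 'm. A *v y)"
    by (rule linearI)
      (simp_all add: vec_eq_iff matrix_vector_mult_def algebra_simps sum.distrib sum_distrib_left)
  show ?thesis by (simp add: linear_sum[OF lin] linear_scale[OF lin])
qed

lemma outer_product_mult: "outer_product u v *v x = (v \<bullet> x) *\<^sub>R u"
  by (simp add: vec_eq_iff matrix_vector_mult_def outer_product_def inner_vec_def
      sum_distrib_left mult_ac)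

lemma edge_laplacian_mult:
  "edge_laplacian i j *v x = (x $ i - x $ j) *\<^sub>R (axis i 1 - axis j 1)"
  by (simp add: edge_laplacian_def outer_product_mult inner_diff_left inner_axis')

lemma transpose_edge_laplacian: "transpose (edge_laplacian i j) = edge_laplacian i j"
  by (simp add: vec_eq_iff transpose_def edge_laplacian_def outer_product_def mult.commute)

lemma sum_less_pairs:
  fixes g :: "'n::{finite,linorder} \<Rightarrow> 'n \<Rightarrow> real"
  assumes "\<And>i. g i i = 0"
  shows "(\<Sum>(i, j) | i < j. g i j + g j i) = (\<Sum>i\<in>UNIV. \<Sum>j\<in>UNIV. g i j)"
proof -
  have swap: "(\<Sum>(i, j) | i < j. g j i) = (\<Sum>(i, j) | j < i. g i j)"
    by (rule sum.reindex_bij_witness[of _ "\<lambda>(i, j). (j, i)" "\<lambda>(i, j). (j, i)"]) auto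
  have "(\<Sum>i\<in>UNIV. \<Sum>j\<in>UNIV. g i j) = (\<Sum>(i, j)\<in>UNIV \<times> UNIV. g i j)"
    by (rule sum.cartesian_product)
  also have "\<dots> = (\<Sum>(i, j)\<in>{(i, j). i < j} \<union> {(i, j). j < i}. g i j)"
    by (rule sum.mono_neutral_right) (use assms in \<open>auto simp: not_less_iff_gr_or_eq\<close>)
  also have "\<dots> = (\<Sum>(i, j) | i < j. g i j) + (\<Sum>(i, j) | j < i. g i j)"
    by (rule sum.union_disjoint) auto
  finally show ?thesis unfolding swap[symmetric] by (simp add: sum.distrib case_prod_unfold)
qed

lemma schur_clique_mult:
  assumes a: "0 < sum a UNIV"
  shows "(schur_clique a *v x) $ k = a k * x $ k - a k * (\<Sum>j\<in>UNIV. a j * x $ j) / sum a UNIV"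
proof -
  \<comment> \<open>\<open>g i j\<close> is what the edge contributes to coordinate \<open>k\<close>
    through its end \<open>i\<close>, so \<open>g i j + g j i\<close> is its whole
    contribution.\<close>
  define g where "g i j = a i * a j / sum a UNIV * (x $ i - x $ j) * of_bool (i = k)" for i j
  have "schur_clique a *v x =
      (\<Sum>e | fst e < snd e. (a (fst e) * a (snd e) / sum a UNIV) *\<^sub>R (edge_laplacian (fst e) (snd e) *v x))"
    unfolding schur_clique_def case_prod_unfold by (rule sum_scaleR_matrix_vector_mult)
  then have "(schur_clique a *v x) $ k = (\<Sum>(i, j) | i < j. g i j + g j i)"
    by (simp add: edge_laplacian_mult case_prod_unfold)
      (intro sum.cong refl, auto simp: g_def axis_def algebra_simps diff_divide_distrib)
  also have "\<dots> = (\<Sum>i\<in>UNIV. \<Sum>j\<in>UNIV. g i j)"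
    by (rule sum_less_pairs) (simp add: g_def)
  also have "\<dots> = (\<Sum>i\<in>UNIV. if i = k then \<Sum>j\<in>UNIV. a k * a j / sum a UNIV * (x $ k - x $ j) else 0)"
    by (intro sum.cong refl) (simp add: g_def)
  also have "\<dots> = (\<Sum>j\<in>UNIV. a k * x $ k / sum a UNIV * a j - a k / sum a UNIV * (a j * x $ j))"
    by (simp add: algebra_simps diff_divide_distrib)
  also have "\<dots> = a k * x $ k - a k * (\<Sum>j\<in>UNIV. a j * x $ j) / sum a UNIV"
    using a unfolding sum_subtractf sum_distrib_left[symmetric] by simp
  finally show ?thesis .
qed

lemma transpose_schur_clique: "transpose (schur_clique a) = schur_clique a"
  unfolding schur_clique_def
  by (rule symmetric_sum) (auto intro!: symmetric_scaleR transpose_edge_laplacian)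

text \<open>The orthogonal projection onto the complement of the constant vectors.\<close>

definition centering :: "real ^ 'n ^ 'n" where
  "centering = (\<chi> i j. of_bool (i = j) - 1 / real CARD('n))"

definition diagonal :: "('n \<Rightarrow> real) \<Rightarrow> real ^ 'n ^ 'n" where
  "diagonal b = (\<chi> i j. if i = j then b i else 0)"

lemma centering_mult:
  "(centering *v x :: real ^ 'n) $ i = x $ i - (\<Sum>j\<in>UNIV. x $ j) / real CARD('n)"
proof -
  have "(centering *v x) $ i = (\<Sum>j\<in>UNIV. (if i = j then x $ j else 0) - x $ j / real CARD('n))"
    unfolding centering_def matrix_vector_mult_def by (simp, intro sum.cong) (auto simp: algebra_simps)
  then show ?thesis by (simp add: sum_subtractf sum_divide_distrib)
qed

lemma sum_centering_mult: "(\<Sum>i\<in>UNIV. (centering *v x :: real ^ 'n) $ i) = 0"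
  by (simp add: centering_mult sum_subtractf)

lemma centering_fixes: "(\<Sum>j\<in>UNIV. x $ j) = 0 \<Longrightarrow> centering *v x = (x :: real ^ 'n)"
  by (simp add: vec_eq_iff centering_mult)

lemma diagonal_mult: "(diagonal b *v x) $ i = b i * x $ i"
  unfolding diagonal_def matrix_vector_mult_def by (simp add: if_distrib[of "\<lambda>y. y * _"] cong: if_cong)

lemma transpose_centering: "transpose (centering :: real ^ 'n ^ 'n) = centering"
  by (auto simp: vec_eq_iff transpose_def centering_def)

lemma transpose_diagonal: "transpose (diagonal b) = diagonal b"
  by (auto simp: vec_eq_iff transpose_def diagonal_def)

text \<open>With \<open>t = \<Sum>\<^sub>i a\<^sub>i\<close> the clique is \<open>diag a - a a\<^sup>T / t\<close>, a rank-one perturbation of a diagonal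
  matrix, so inverting the diagonal on the orthogonal complement of the constants inverts it.\<close>

lemma is_pseudoinverse_schur_clique:
  fixes a :: "'n::{finite,linorder} \<Rightarrow> real"
  assumes a: "\<And>i. 0 < a i"
  shows "is_pseudoinverse (schur_clique a) (centering ** diagonal (\<lambda>i. 1 / a i) ** centering)"
proof -
  let ?K = "schur_clique a" and ?D = "diagonal (\<lambda>i. 1 / a i)" and ?C = "centering :: ((real, 'n) vec, 'n) vec"
  have t: "0 < sum a UNIV" using a by (intro sum_pos) auto
  \<comment> \<open>The clique annihilates constants, so subtracting the mean changes
    nothing.\<close>
  have KC: "?K ** ?C = ?K"
    unfolding matrix_eq
  proof
    fix x :: "(real, 'n) vec"
    define m where "m = (\<Sum>j\<in>UNIV. x $ j) / real CARD('n)"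
    have eq: "(\<Sum>j\<in>UNIV. a j * (?C *v x) $ j) = (\<Sum>j\<in>UNIV. a j * x $ j) - m * sum a UNIV"
      by (simp add: centering_mult m_def[symmetric] right_diff_distrib sum_subtractf
          mult.commute sum_distrib_left)
    show "?K ** ?C *v x = ?K *v x"
      unfolding vec_eq_iff matrix_vector_mul_assoc[symmetric] schur_clique_mult[OF t] eq
      using t by (simp add: centering_mult m_def[symmetric] field_simps)
  qed
  \<comment> \<open>After dividing by \<open>a\<close>, the rank-one part of the clique sees only
    the coordinate sum of a centered vector, which is zero.\<close>
  have KDC: "?K ** ?D ** ?C = ?C"
    unfolding matrix_eq
  proof
    fix x :: "(real, 'n) vec"
    have nz: "a j \<noteq> 0" for j using a[of j] by simp
    show "?K ** ?D ** ?C *v x = ?C *v x"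
      using sum_centering_mult[of x]
      by (simp add: vec_eq_iff matrix_vector_mul_assoc[symmetric] schur_clique_mult[OF t]
          diagonal_mult nz)
  qed
  have CC: "?C ** ?C = ?C"
    unfolding matrix_eq
    by (simp add: matrix_vector_mul_assoc[symmetric] centering_fixes sum_centering_mult)
  let ?M = "?C ** ?D ** ?C"
  have KM: "?K ** ?M = ?C"
    using KDC by (simp add: matrix_mul_assoc KC)
  have "transpose ?M = ?M"
    by (rule symmetric_congruence[OF transpose_diagonal transpose_centering])
  then have MK: "?M ** ?K = ?C"
    using KM by (metis matrix_transpose_mul transpose_centering transpose_schur_clique)
  have CK: "?C ** ?K = ?K"
    using KC by (metis matrix_transpose_mul transpose_centering transpose_schur_clique)
  have "?M ** ?K ** ?M = ?M"
    unfolding MK by (simp add: matrix_mul_assoc CC)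
  then show ?thesis
    unfolding is_pseudoinverse_def KM MK by (simp add: CK transpose_centering)
qed

text \<open>Only the symmetry and the square of the root enter: the squared norm is the quadratic
  form of the pseudoinverse at a difference of basis vectors, which \<open>centering\<close> fixes,
  so just the diagonal matrix remains.\<close>

lemma pinv_sqrt_schur_clique:
  fixes a :: "'n::{finite,linorder} \<Rightarrow> real"
  assumes a: "\<And>i. 0 < a i"
  shows transpose_pinv_sqrt: "transpose (pinv_sqrt (schur_clique a)) = pinv_sqrt (schur_clique a)"
    and norm_pinv_sqrt_edge: "i \<noteq> j \<Longrightarrow>
      (norm (pinv_sqrt (schur_clique a) *v (axis i 1 - axis j 1)))\<^sup>2 = 1 / a i + 1 / a j"
proof -
  let ?D = "diagonal (\<lambda>i. 1 / a i)" and ?C = "centering :: ((real, 'n) vec, 'n) vec"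
  let ?M = "?C ** ?D ** ?C" and ?S = "pinv_sqrt (schur_clique a)"
  have pinv: "pseudoinverse (schur_clique a) = ?M"
    by (rule pseudoinverse_eqI[OF is_pseudoinverse_schur_clique[OF a]])
  have quad: "x \<bullet> (?M *v x) = (?C *v x) \<bullet> (?D *v (?C *v x))" for x
    using symmetric_inner[OF transpose_centering, of x]
    by (simp add: matrix_vector_mul_assoc[symmetric])
  have "psd ?M"
    unfolding psd_def
  proof (intro conjI allI)
    show "transpose ?M = ?M"
      by (rule symmetric_congruence[OF transpose_diagonal transpose_centering])
    show "0 \<le> x \<bullet> (?M *v x)" for x
      unfolding quad unfolding inner_vec_def using a
      by (intro sum_nonneg) (simp add: diagonal_mult less_imp_le)
  qed
  then have S: "transpose ?S = ?S" "?S ** ?S = ?M"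
    using psd_psd_sqrt[of ?M] psd_sqrt_square[of ?M] by (simp_all add: pinv_sqrt_def pinv psd_def)
  show "transpose ?S = ?S" by (rule S)
  assume ij: "i \<noteq> j"
  let ?b = "axis i 1 - axis j 1 :: (real, 'n) vec"
  have "(\<Sum>k\<in>UNIV. ?b $ k) = 0" by (simp add: sum_subtractf axis_def)
  then have Cb: "?C *v ?b = ?b" by (rule centering_fixes)
  have "(norm (?S *v ?b))\<^sup>2 = ?b \<bullet> (?S *v (?S *v ?b))"
    unfolding power2_norm_eq_inner by (rule symmetric_inner[OF S(1), symmetric])
  also have "\<dots> = ?b \<bullet> (?D *v ?b)"
    by (simp only: matrix_vector_mul_assoc S(2) quad Cb)
  also have "\<dots> = 1 / a i + 1 / a j"
    using ij by (simp add: inner_diff_left inner_axis' diagonal_mult) (simp add: axis_def)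
  finally show "(norm (?S *v ?b))\<^sup>2 = 1 / a i + 1 / a j" .
qed

section \<open>The CAST update\<close>

locale cast =
  fixes a :: "'n::{finite,linorder} \<Rightarrow> real" and \<rho> :: nat
  assumes a_pos: "0 < a i" and rho_pos: "1 \<le> \<rho>"
begin

abbreviation nodes :: "('n \<times> nat) set" where
  "nodes \<equiv> copies \<rho>"

section \<open>From copies back to labels\<close>

lemma sum_over_copies:
  fixes f :: "'n \<Rightarrow> 'b::real_vector"
  shows "(\<Sum>p\<in>nodes. f (label p)) = real \<rho> *\<^sub>R (\<Sum>i\<in>UNIV. f i)"
proof -
  have "(\<Sum>p\<in>nodes. f (label p)) = (\<Sum>(i, k)\<in>UNIV \<times> {1..\<rho>}. f i)"
    by (simp add: copies_def case_prod_unfold)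
  also have "\<dots> = (\<Sum>i\<in>UNIV. \<Sum>k\<in>{1..\<rho>}. f i)"
    by (rule sum.cartesian_product[symmetric])
  finally show ?thesis by (simp add: sum_constant_scaleR scaleR_right.sum)
qed

lemma sum_conductance: "sum (conductance a \<rho>) (nodes) = sum a UNIV"
  using sum_over_copies[of "\<lambda>i. a i / real \<rho>"] rho_pos
  by (simp add: conductance_def sum_divide_distrib[symmetric])

sublocale clique: weighted_clique "nodes" "conductance a \<rho>"
proof
  show "finite (nodes)" by (simp add: copies_def)
  show "nodes \<noteq> {}" using rho_pos by (auto simp: copies_def)
  show "0 < conductance a \<rho> p" for p
    using a_pos rho_pos by (simp add: conductance_def)
qed

lemma cast_tree_eq: "cast_tree a \<rho> = clique.tree_law"
proof -
  have "clique.weight = expanded_weight a \<rho>"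
    by (simp add: fun_eq_iff clique.weight_def expanded_weight_def sum_conductance)
  then show ?thesis by (simp add: cast_tree_def clique.tree_law_def)
qed

text \<open>The orientation is that of \<open>cast_update\<close>; it also ensures that no pair
  occurs together with its reverse, as \<open>second_moment_le\<close> requires.\<close>

definition cross :: "(('n \<times> nat) \<times> ('n \<times> nat)) set" where
  "cross = {(p, q). p \<in> nodes \<and> q \<in> nodes \<and> label p < label q}"

definition coef :: "'n \<Rightarrow> 'n \<Rightarrow> real" where
  "coef i j = a i * a j / (real \<rho> * (a i + a j))"

definition term_matrix :: "('n \<times> nat) \<times> ('n \<times> nat) \<Rightarrow> ((real, 'n) vec, 'n) vec" where
  "term_matrix e = coef (label (fst e)) (label (snd e)) *\<^sub>R
     edge_laplacian (label (fst e)) (label (snd e))"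

lemma finite_cross: "finite cross"
  by (rule finite_subset[of _ "nodes \<times> nodes"]) (auto simp: cross_def copies_def)

lemma coef_conductance:
  "conductance a \<rho> p * conductance a \<rho> q / (conductance a \<rho> p + conductance a \<rho> q)
    = coef (label p) (label q)"
  using rho_pos a_pos[of "label p"] a_pos[of "label q"]
  by (simp add: conductance_def coef_def add_divide_distrib[symmetric])

lemma cast_update_eq:
  assumes T: "T \<in> spanning_trees (nodes)"
  shows "cast_update a \<rho> T = (\<Sum>e\<in>cross. of_bool ({fst e, snd e} \<in> T) *\<^sub>R term_matrix e)"
proof -
  have "{(p, q). {p, q} \<in> T \<and> label p < label q} = {e \<in> cross. {fst e, snd e} \<in> T}"
    using clique.tree_subset[OF T] clique.edge_iff by (fastforce simp: cross_def)
  then have "cast_update a \<rho> T = (\<Sum>e\<in>{e \<in> cross. {fst e, snd e} \<in> T}. term_matrix e)"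
    by (simp add: cast_update_def coef_conductance term_matrix_def case_prod_unfold)
  also have "\<dots> = (\<Sum>e\<in>cross. if {fst e, snd e} \<in> T then term_matrix e else 0)"
    by (rule sum.inter_filter[OF finite_cross])
  also have "\<dots> = (\<Sum>e\<in>cross. of_bool ({fst e, snd e} \<in> T) *\<^sub>R term_matrix e)"
    by (intro sum.cong) auto
  finally show ?thesis .
qed

text \<open>Every pair of labels is represented by \<open>\<rho>\<^sup>2\<close> pairs of
  copies.\<close>

lemma sum_over_cross:
  fixes f :: "'n \<Rightarrow> 'n \<Rightarrow> 'b::real_vector"
  shows "(\<Sum>e\<in>cross. f (label (fst e)) (label (snd e))) = (real \<rho>)\<^sup>2 *\<^sub>R (\<Sum>(i, j) | i < j. f i j)"
proof -
  have fin: "finite (nodes \<times> nodes)" by (simp add: copies_def)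
  have "(\<Sum>e\<in>cross. f (label (fst e)) (label (snd e))) =
      (\<Sum>e\<in>{e \<in> nodes \<times> nodes. label (fst e) < label (snd e)}. f (label (fst e)) (label (snd e)))"
    by (rule sum.cong) (auto simp: cross_def)
  also have "\<dots> = (\<Sum>e\<in>nodes \<times> nodes.
      if label (fst e) < label (snd e) then f (label (fst e)) (label (snd e)) else 0)"
    by (rule sum.inter_filter[OF fin])
  also have "\<dots> = (\<Sum>p\<in>nodes. \<Sum>q\<in>nodes.
      if label p < label q then f (label p) (label q) else 0)"
    by (simp add: sum.cartesian_product case_prod_unfold)
  also have "\<dots> = (\<Sum>p\<in>nodes. real \<rho> *\<^sub>R (\<Sum>j\<in>UNIV. if label p < j then f (label p) j else 0))"
    by (intro sum.cong refl) (rule sum_over_copies)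
  also have "\<dots> = real \<rho> *\<^sub>R (\<Sum>i\<in>UNIV. real \<rho> *\<^sub>R (\<Sum>j\<in>UNIV. if i < j then f i j else 0))"
    by (rule sum_over_copies)
  also have "\<dots> = (real \<rho>)\<^sup>2 *\<^sub>R (\<Sum>e\<in>UNIV \<times> UNIV. if fst e < snd e then f (fst e) (snd e) else 0)"
    by (simp add: sum.cartesian_product case_prod_unfold scaleR_right.sum[symmetric] power2_eq_square)
  also have "(\<Sum>e\<in>UNIV \<times> UNIV. if fst e < snd e then f (fst e) (snd e) else 0)
      = (\<Sum>(i, j) | i < j. f i j)"
    using sum.inter_filter[of "UNIV :: ('n \<times> 'n) set" "\<lambda>e. f (fst e) (snd e)" "\<lambda>e. fst e < snd e"]
    by (simp add: case_prod_unfold)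
  finally show ?thesis .
qed

text \<open>The source of unbiasedness: the sum of conductances in the edge probability cancels the
  denominator of \<open>coef\<close>, leaving an equal share of the clique weight for each of the
  \<open>\<rho>\<^sup>2\<close> pairs of copies.\<close>

lemma edge_prob_coef:
  "clique.edge_prob e * coef (label (fst e)) (label (snd e))
    = a (label (fst e)) * a (label (snd e)) / sum a UNIV / (real \<rho>)\<^sup>2"
  unfolding clique.edge_prob_def sum_conductance
  using rho_pos a_pos[of "label (fst e)"] a_pos[of "label (snd e)"]
  by (simp add: conductance_def coef_def add_divide_distrib[symmetric] power2_eq_square)

lemma schur_clique_eq: "schur_clique a = (\<Sum>e\<in>cross. clique.edge_prob e *\<^sub>R term_matrix e)"
proof -
  have "(\<Sum>e\<in>cross. clique.edge_prob e *\<^sub>R term_matrix e) = (\<Sum>e\<in>cross.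
      (a (label (fst e)) * a (label (snd e)) / sum a UNIV / (real \<rho>)\<^sup>2) *\<^sub>R
        edge_laplacian (label (fst e)) (label (snd e)))"
    by (simp add: term_matrix_def edge_prob_coef)
  also have "\<dots> = (real \<rho>)\<^sup>2 *\<^sub>R (\<Sum>(i, j) | i < j.
      (a i * a j / sum a UNIV / (real \<rho>)\<^sup>2) *\<^sub>R edge_laplacian i j)"
    by (rule sum_over_cross)
  also have "\<dots> = schur_clique a"
    using rho_pos by (simp add: schur_clique_def scaleR_right.sum case_prod_unfold)
  finally show ?thesis by (rule sym)
qed

section \<open>Moments of the normalized error\<close>

abbreviation pinv_root :: "((real, 'n) vec, 'n) vec" where
  "pinv_root \<equiv> pinv_sqrt (schur_clique a)"

text \<open>Separates centered random scalars from fixed matrices, the form in which the edge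
  correlations apply.\<close>

lemma schur_error_eq:
  assumes "T \<in> spanning_trees (nodes)"
  shows "schur_error a \<rho> T = (\<Sum>e\<in>cross.
    (of_bool ({fst e, snd e} \<in> T) - clique.edge_prob e) *\<^sub>R (pinv_root ** term_matrix e ** pinv_root))"
proof -
  have "cast_update a \<rho> T - schur_clique a =
      (\<Sum>e\<in>cross. (of_bool ({fst e, snd e} \<in> T) - clique.edge_prob e) *\<^sub>R term_matrix e)"
    by (simp only: cast_update_eq[OF assms] scaleR_left_diff_distrib sum_subtractf)
      (simp only: schur_clique_eq[symmetric])
  then show ?thesis unfolding schur_error_def by (simp only: matrix_mul_sum_scaleR)
qed

lemma cross_edge:
  assumes "e \<in> cross"
  shows "fst e \<in> nodes" "snd e \<in> nodes" "fst e \<noteq> snd e" "label (fst e) \<noteq> label (snd e)"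
  using assms by (auto simp: cross_def)

lemma expectation_schur_error:
  "measure_pmf.expectation (cast_tree a \<rho>) (\<lambda>T. schur_error a \<rho> T) = 0"
proof -
  let ?Z = "\<lambda>e. pinv_root ** term_matrix e ** pinv_root" and ?P = "pmf clique.tree_law"
  have "measure_pmf.expectation (cast_tree a \<rho>) (\<lambda>T. schur_error a \<rho> T) =
      (\<Sum>T\<in>spanning_trees (nodes). \<Sum>e\<in>cross.
        (?P T * of_bool ({{fst e, snd e}} \<subseteq> T) - ?P T * clique.edge_prob e) *\<^sub>R ?Z e)"
    unfolding cast_tree_eq clique.expectation_tree_law
    by (intro sum.cong refl) (simp add: schur_error_eq scaleR_right.sum right_diff_distrib)
  also have "\<dots> = (\<Sum>e\<in>cross. (\<Sum>T\<in>spanning_trees (nodes).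
        ?P T * of_bool ({{fst e, snd e}} \<subseteq> T) - ?P T * clique.edge_prob e) *\<^sub>R ?Z e)"
    unfolding scaleR_left.sum by (rule sum.swap)
  also have "\<dots> = (\<Sum>e\<in>cross. 0)"
  proof (rule sum.cong[OF refl])
    fix e assume e: "e \<in> cross"
    have "(\<Sum>T\<in>spanning_trees (nodes).
        ?P T * of_bool ({{fst e, snd e}} \<subseteq> T) - ?P T * clique.edge_prob e) = 0"
      unfolding sum_subtractf clique.prob_over_eq_sum[symmetric] sum_distrib_right[symmetric]
        clique.sum_pmf_tree_law
      using clique.prob_over_edge[OF cross_edge(1-3)[OF e]] by simp
    then show "(\<Sum>T\<in>spanning_trees (nodes).
        ?P T * of_bool ({{fst e, snd e}} \<subseteq> T) - ?P T * clique.edge_prob e) *\<^sub>R ?Z e = 0"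
      by simp
  qed
  finally show ?thesis by simp
qed

lemma transpose_root: "transpose pinv_root = pinv_root"
  by (rule transpose_pinv_sqrt[OF a_pos])

lemma transpose_schur_error:
  assumes "T \<in> spanning_trees (nodes)"
  shows "transpose (schur_error a \<rho> T) = schur_error a \<rho> T"
  unfolding schur_error_eq[OF assms]
  by (intro symmetric_sum symmetric_scaleR symmetric_congruence transpose_root)
    (simp add: term_matrix_def symmetric_scaleR transpose_edge_laplacian)

lemma term_matrix_mult:
  "term_matrix e *v y = (coef (label (fst e)) (label (snd e)) *
     (y $ label (fst e) - y $ label (snd e))) *\<^sub>R (axis (label (fst e)) 1 - axis (label (snd e)) 1)"
  using sum_scaleR_matrix_vector_mult[of "\<lambda>_. coef (label (fst e)) (label (snd e))"
      "\<lambda>_. edge_laplacian (label (fst e)) (label (snd e))" "{()}" y]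
  by (simp add: term_matrix_def edge_laplacian_mult)

text \<open>Every normalized edge term is a rank-one matrix of trace \<open>1 / \<rho>\<close>.\<close>

lemma norm_term:
  assumes e: "e \<in> cross"
  shows "(norm (pinv_root ** term_matrix e ** pinv_root *v x))\<^sup>2
    = 1 / real \<rho> * ((pinv_root *v x) \<bullet> (term_matrix e *v (pinv_root *v x)))"
proof -
  let ?i = "label (fst e)" and ?j = "label (snd e)" and ?y = "pinv_root *v x"
  \<comment> \<open>This is the trace of the normalized term, the coefficient times the squared norm
    of its rank-one direction; it depends on neither label.\<close>
  have trace: "coef ?i ?j * (1 / a ?i + 1 / a ?j) = 1 / real \<rho>"
    using a_pos[of ?i] a_pos[of ?j] rho_pos by (simp add: coef_def divide_simps)
  have edge: "(norm (pinv_root *v (axis ?i 1 - axis ?j 1)))\<^sup>2 = 1 / a ?i + 1 / a ?j"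
    by (rule norm_pinv_sqrt_edge[OF a_pos cross_edge(4)[OF e]])
  have eq: "pinv_root ** term_matrix e ** pinv_root *v x =
      (coef ?i ?j * (?y $ ?i - ?y $ ?j)) *\<^sub>R (pinv_root *v (axis ?i 1 - axis ?j 1))"
    by (simp only: matrix_vector_mul_assoc[symmetric] term_matrix_mult matrix_vector_mult_scaleR)
  have "(norm (pinv_root ** term_matrix e ** pinv_root *v x))\<^sup>2
      = (coef ?i ?j * (?y $ ?i - ?y $ ?j))\<^sup>2 * (1 / a ?i + 1 / a ?j)"
    unfolding eq edge[symmetric] by (simp add: power_mult_distrib)
  also have "\<dots> = coef ?i ?j * (?y $ ?i - ?y $ ?j)\<^sup>2 * (coef ?i ?j * (1 / a ?i + 1 / a ?j))"
    unfolding power2_eq_square by (simp only: mult_ac)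
  finally have "(norm (pinv_root ** term_matrix e ** pinv_root *v x))\<^sup>2
      = coef ?i ?j * (?y $ ?i - ?y $ ?j)\<^sup>2 * (1 / real \<rho>)"
    unfolding trace .
  then show ?thesis
    by (simp add: term_matrix_mult inner_diff_right inner_axis power2_eq_square)
qed

text \<open>Symmetry of the error turns the quadratic form of its square into a squared norm, so
  \<open>second_moment_le\<close> applies for each fixed \<open>x\<close>.\<close>

lemma second_moment_schur_error:
  "measure_pmf.expectation (cast_tree a \<rho>) (\<lambda>T. schur_error a \<rho> T ** schur_error a \<rho> T)
    \<preceq>\<^sub>L (1 / real \<rho>) *\<^sub>R range_projection (schur_clique a)" (is "?E \<preceq>\<^sub>L ?R")
proof -
  let ?Tr = "spanning_trees (nodes)" and ?P = "pmf clique.tree_law"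
  have E: "?E = (\<Sum>T\<in>?Tr. ?P T *\<^sub>R (schur_error a \<rho> T ** schur_error a \<rho> T))"
    unfolding cast_tree_eq by (rule clique.expectation_tree_law)
  have symE: "transpose ?E = ?E"
    unfolding E
    by (intro symmetric_sum symmetric_scaleR) (simp add: matrix_transpose_mul transpose_schur_error)
  have symR: "transpose ?R = ?R"
    unfolding range_projection_def
    by (intro symmetric_scaleR symmetric_congruence transpose_root transpose_schur_clique)
  have le: "x \<bullet> (?E *v x) \<le> x \<bullet> (?R *v x)" for x
  proof -
    have "x \<bullet> (?E *v x) = (\<Sum>T\<in>?Tr. ?P T * (norm (schur_error a \<rho> T *v x))\<^sup>2)"
      unfolding E sum_scaleR_matrix_vector_mult inner_sum_right
    proof (rule sum.cong[OF refl])
      fix T assume T: "T \<in> ?Tr"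
      show "x \<bullet> (?P T *\<^sub>R (schur_error a \<rho> T ** schur_error a \<rho> T *v x))
          = ?P T * (norm (schur_error a \<rho> T *v x))\<^sup>2"
        using symmetric_inner[OF transpose_schur_error[OF T], of x "schur_error a \<rho> T *v x"]
        by (simp add: matrix_vector_mul_assoc power2_norm_eq_inner)
    qed
    also have "\<dots> = (\<Sum>T\<in>?Tr. ?P T * (norm (\<Sum>e\<in>cross.
        (of_bool ({fst e, snd e} \<in> T) - clique.edge_prob e) *\<^sub>R
          (pinv_root ** term_matrix e ** pinv_root *v x)))\<^sup>2)"
      by (intro sum.cong refl) (simp add: schur_error_eq sum_scaleR_matrix_vector_mult)
    also have "\<dots> \<le> (\<Sum>e\<in>cross. clique.edge_prob e * (norm (pinv_root ** term_matrix e ** pinv_root *v x))\<^sup>2)"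
      by (rule clique.second_moment_le) (auto simp: cross_def)
    \<comment> \<open>By \<open>norm_term\<close> each summand becomes linear in the edge matrix, so
      the weighted sum reassembles the clique.\<close>
    also have "\<dots> = (\<Sum>e\<in>cross. 1 / real \<rho> *
        ((pinv_root *v x) \<bullet> (clique.edge_prob e *\<^sub>R (term_matrix e *v (pinv_root *v x)))))"
      by (intro sum.cong refl) (simp add: norm_term)
    also have "\<dots> = 1 / real \<rho> * ((pinv_root *v x) \<bullet> (schur_clique a *v (pinv_root *v x)))"
      by (simp only: sum_distrib_left[symmetric] inner_sum_right[symmetric]
          sum_scaleR_matrix_vector_mult[symmetric] schur_clique_eq[symmetric])
    also have "\<dots> = x \<bullet> (?R *v x)"
      using symmetric_inner[OF transpose_root, of x "schur_clique a *v (pinv_root *v x)"]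
        sum_scaleR_matrix_vector_mult[of "\<lambda>_. 1 / real \<rho>" "\<lambda>_. range_projection (schur_clique a)" "{()}" x]
      by (simp add: range_projection_def matrix_vector_mul_assoc[symmetric])
    finally show ?thesis .
  qed
  have "psd (?R - ?E)"
    unfolding psd_def
  proof (intro conjI allI)
    show "transpose (?R - ?E) = ?R - ?E"
      using symE symR by (simp add: vec_eq_iff transpose_def)
    show "0 \<le> x \<bullet> ((?R - ?E) *v x)" for x
      using le[of x] by (simp add: matrix_vector_mult_diff_rdistrib inner_diff_right)
  qed
  then show ?thesis using symE symR by (simp add: loewner_le_def)
qed

end

theorem theorem4p8:
  fixes a :: "'n::{finite,linorder} \<Rightarrow> real" and \<rho> :: nat
  assumes "2 \<le> CARD('n)"
    and "\<And>i. 0 < a i"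
    and "1 \<le> \<rho>"
  shows "measure_pmf.expectation (cast_tree a \<rho>) (\<lambda>T. schur_error a \<rho> T) = 0 \<and>
    measure_pmf.expectation (cast_tree a \<rho>) (\<lambda>T. schur_error a \<rho> T ** schur_error a \<rho> T)
      \<preceq>\<^sub>L (1 / real \<rho>) *\<^sub>R range_projection (schur_clique a)"
proof -
  interpret cast a \<rho> by unfold_locales (use assms in auto)
  show ?thesis using expectation_schur_error second_moment_schur_error by blast
qed

end
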